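(* Let $\Psi=\forall x\forall y\,\psi_0(x,y)\wedge\bigwedge_{i=1}^m\gamma_i\wedge\bigwedge_{i=1}^{\bar m}\delta_i$ be a normal-form sentence of $\mathrm{FO}^2_T$ with transitive witnesses over the signature $\sigma$ (as described in the context). Then $\Psi$ has a model (with $T$ transitive) if and only if there exist a $\sigma$-structure $\mathfrak A$ and sets $S_0,S_1,S_2,S_3\subseteq A$ such that: (1) $|A|\le 4\cdot\mathbb M$; (2) either $S_1=S_2=S_3=\emptyset$, or $\{S_0,S_1,S_2,S_3\}$ is a partition of $A$ and then (a) $\langle S_0,S_1\rangle\approx_{\mathfrak A}\langle S_0,S_2\rangle\approx_{\mathfrak A}\langle S_0,S_3\rangle$ and (b) $\langle S_1,S_2\rangle\approx_{\mathfrak A}\langle S_2,S_3\rangle\approx_{\mathfrak A}\langle S_1,S_3\rangle$; (3) for every $a,b\in A$, $tp^{\mathfrak A}[a,b]\models\psi_0$; (4) $T^{\mathfrak A}$ is transitive; (5) for every $j\in\{0,1,2\}$, every $a\in S_j$ and every $i\in\{1,\dots,m\}$: if $W_i^{\mathfrak A}(a)\cap S_0=\emptyset$ then $W_i^{\mathfrak A}(a)\cap S_{j+1}\neq\emptyset$; (6) for every $a\in A$ and every $i\in\{1,\dots,\bar m\}$, $a$ has a $\delta_i$-witness in $Cl^{\mathfrak A}(a)$, i.e. there is $b\in Cl^{\mathfrak A}(a)$ with $\mathfrak A\models\psi_i^{\leftrightarrow}[a,b]$.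
   Context: Signatures are relational, with predicates of arity at most 2, and contain a distinguished binary predicate $T$; $\mathrm{FO}^2_T$ is two-variable first-order logic with equality over such signatures, where models must interpret $T$ transitively. For quantifier-free $\psi(x,y)$ let $\psi^{\rightarrow}:=Txy\wedge\neg Tyx\wedge\psi$, $\psi^{\leftarrow}:=\neg Txy\wedge Tyx\wedge\psi$, $\psi^{\leftrightarrow}:=Txy\wedge Tyx\wedge\psi$. A normal-form sentence with transitive witnesses is $\Psi=\forall x\forall y\,\psi_0\wedge\bigwedge_{i=1}^m\gamma_i\wedge\bigwedge_{i=1}^{\bar m}\delta_i$ with $\gamma_i=\forall x\exists y\,\psi_i^{d_i}(x,y)$, $d_i\in\{\rightarrow,\leftarrow\}$, $\delta_i=\forall x\exists y\,\psi_i^{\leftrightarrow}(x,y)$, all $\psi_i$ quantifier-free; $\sigma$ is the set of symbols of $\Psi$. $tp^{\mathfrak A}[a]$ is the 1-type of $a$ (the set of atoms and negated atoms in the variable $x$ true of $a$), and for $a\ne b$, $tp^{\mathfrak A}[a,b]$ is the 2-type of the pair (atoms and negated atoms in $x,y$, including $x\neq y$). A set $B\subseteq A$ is $T$-connected if $Tbc$ holds for all distinct $b,c\in B$; cliques are maximal $T$-connected sets; $Cl^{\mathfrak A}(a)$ is the clique containing $a$. $W_i^{\mathfrak A}(a)=\{b\in A: b\neq a,\ \mathfrak A\models\psi_i^{d_i}[a,b]\}$. For disjoint $X,Y$ and disjoint $X',Y'$ in $A$, $\langle X',Y'\rangle\approx_{\mathfrak A}\langle X,Y\rangle$ means that there are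 isomorphisms $f:\mathfrak A\restriction X'\to\mathfrak A\restriction X$ and $g:\mathfrak A\restriction Y'\to\mathfrak A\restriction Y$ with $tp^{\mathfrak A}[b,c]=tp^{\mathfrak A}[f(b),g(c)]$ for all $b\in X'$, $c\in Y'$ (for segments indexed $S_j$, it is required that the first index is smaller than the second). The splice of a clique $B$ is the triple consisting of the isomorphism type of $\mathfrak A\restriction B$, the set of 1-types of elements $a$ with $a<B$, and the set of 1-types of elements $a$ with $B<a$, where $a<B$ means $Tab\wedge\neg Tba$ for all $b\in B$ (and symmetrically). Let $h$ be the bound, exponential in $|\sigma|$, on clique sizes given by the small clique property (every satisfiable normal-form sentence over $\sigma$ has a model all of whose cliques have at most $h$ elements), let $s$ be a fixed bound, doubly exponential in $|\sigma|$, on the number of distinct splices in a $\sigma$-structure whose cliques have at most $h$ elements, and $\mathbb M=(m+1)\cdot s^2\cdot h$.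
   Formalization: In (2), the isomorphisms in (a) and (b) all come from one identification S1→S2→S3 with S0 fixed pointwise; with independently chosen isomorphisms the "if" direction fails. In the case S1=S2=S3=∅, S0=A is required, since otherwise (5) can be vacuous. *)

theory Defs
  imports Complex_Main "HOL-Library.Disjoint_Sets" "HOL-Library.Infinite_Typeclass"
begin

section \<open>Syntax\<close>

text \<open>Predicate symbols of arity 0, 1, 2 together with the distinguished binary symbol \<open>T\<close>.\<close>

datatype 'p symb = T | P0 'p | P1 'p | P2 'p

datatype var = X | Y

datatype 'p atom =
    Eq var var
  | TRel var var
  | Rel0 'p
  | Rel1 'p var
  | Rel2 'p var var

datatype 'p fo2 =
    Atom "'p atom"
  | Neg "'p fo2"
  | Conj "'p fo2" "'p fo2"
  | Disj "'p fo2" "'p fo2"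
  | Forall var "'p fo2"
  | Exists var "'p fo2"

fun quantifier_free :: "'p fo2 \<Rightarrow> bool" where
  "quantifier_free (Atom \<alpha>) = True"
| "quantifier_free (Neg \<phi>) = quantifier_free \<phi>"
| "quantifier_free (Conj \<phi> \<psi>) = (quantifier_free \<phi> \<and> quantifier_free \<psi>)"
| "quantifier_free (Disj \<phi> \<psi>) = (quantifier_free \<phi> \<and> quantifier_free \<psi>)"
| "quantifier_free (Forall v \<phi>) = False"
| "quantifier_free (Exists v \<phi>) = False"

fun atom_symbols :: "'p atom \<Rightarrow> 'p symb set" where
  "atom_symbols (Eq u v) = {}"
| "atom_symbols (TRel u v) = {T}"
| "atom_symbols (Rel0 p) = {P0 p}"
| "atom_symbols (Rel1 p u) = {P1 p}"
| "atom_symbols (Rel2 p u v) = {P2 p}"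

fun atom_vars :: "'p atom \<Rightarrow> var set" where
  "atom_vars (Eq u v) = {u, v}"
| "atom_vars (TRel u v) = {u, v}"
| "atom_vars (Rel0 p) = {}"
| "atom_vars (Rel1 p u) = {u}"
| "atom_vars (Rel2 p u v) = {u, v}"

fun symbols :: "'p fo2 \<Rightarrow> 'p symb set" where
  "symbols (Atom \<alpha>) = atom_symbols \<alpha>"
| "symbols (Neg \<phi>) = symbols \<phi>"
| "symbols (Conj \<phi> \<psi>) = symbols \<phi> \<union> symbols \<psi>"
| "symbols (Disj \<phi> \<psi>) = symbols \<phi> \<union> symbols \<psi>"
| "symbols (Forall v \<phi>) = symbols \<phi>"
| "symbols (Exists v \<phi>) = symbols \<phi>"

definition signature :: "'p symb set \<Rightarrow> bool" where
  "signature \<sigma> \<longleftrightarrow> finite \<sigma> \<and> T \<in> \<sigma>"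

text \<open>\<open>guard_dir Fwd \<psi>\<close>, \<open>guard_dir Bwd \<psi>\<close> and \<open>guard_both \<psi>\<close> are
  \<open>\<psi>\<^sup>\<rightarrow>\<close>, \<open>\<psi>\<^sup>\<leftarrow>\<close> and \<open>\<psi>\<^sup>\<leftrightarrow>\<close>.\<close>

datatype dir = Fwd | Bwd

fun guard_dir :: "dir \<Rightarrow> 'p fo2 \<Rightarrow> 'p fo2" where
  "guard_dir Fwd \<psi> = Conj (Conj (Atom (TRel X Y)) (Neg (Atom (TRel Y X)))) \<psi>"
| "guard_dir Bwd \<psi> = Conj (Conj (Neg (Atom (TRel X Y))) (Atom (TRel Y X))) \<psi>"

definition guard_both :: "'p fo2 \<Rightarrow> 'p fo2" where
  "guard_both \<psi> = Conj (Conj (Atom (TRel X Y)) (Atom (TRel Y X))) \<psi>"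

text \<open>The sentence \<open>\<forall>x\<forall>y \<psi>\<^sub>0 \<and> \<And>\<gamma>\<^sub>i \<and> \<And>\<delta>\<^sub>i\<close>; \<open>gs\<close> lists the pairs \<open>(d\<^sub>i, \<psi>\<^sub>i)\<close> of the \<open>\<gamma>\<^sub>i\<close>
  and \<open>ds\<close> lists the formulas \<open>\<psi>\<^sub>i\<close> of the \<open>\<delta>\<^sub>i\<close>.\<close>

definition normal_sentence ::
    "'p fo2 \<Rightarrow> (dir \<times> 'p fo2) list \<Rightarrow> 'p fo2 list \<Rightarrow> 'p fo2" where
  "normal_sentence \<psi>0 gs ds =
     foldl Conj (Forall X (Forall Y \<psi>0))
       (map (\<lambda>(d, \<psi>). Forall X (Exists Y (guard_dir d \<psi>))) gs @
        map (\<lambda>\<psi>. Forall X (Exists Y (guard_both \<psi>))) ds)"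

definition normal_data ::
    "'p fo2 \<Rightarrow> (dir \<times> 'p fo2) list \<Rightarrow> 'p fo2 list \<Rightarrow> bool" where
  "normal_data \<psi>0 gs ds \<longleftrightarrow>
     quantifier_free \<psi>0 \<and> (\<forall>(d, \<psi>)\<in>set gs. quantifier_free \<psi>) \<and> (\<forall>\<psi>\<in>set ds. quantifier_free \<psi>)"

definition normal_form :: "'p fo2 \<Rightarrow> bool" where
  "normal_form \<Psi> \<longleftrightarrow> (\<exists>\<psi>0 gs ds. normal_data \<psi>0 gs ds \<and> \<Psi> = normal_sentence \<psi>0 gs ds)"

section \<open>Semantics\<close>

text \<open>A structure interprets every symbol over \<open>'p\<close>; when it is regarded as a \<open>\<sigma>\<close>-structure,
  only the symbols in \<open>\<sigma>\<close> and the elements of \<open>univ\<close> are ever inspected.\<close>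

record ('p, 'a) struct =
  univ :: "'a set"
  tr :: "'a \<Rightarrow> 'a \<Rightarrow> bool"
  rel0 :: "'p \<Rightarrow> bool"
  rel1 :: "'p \<Rightarrow> 'a \<Rightarrow> bool"
  rel2 :: "'p \<Rightarrow> 'a \<Rightarrow> 'a \<Rightarrow> bool"

fun sat_atom :: "('p, 'a) struct \<Rightarrow> (var \<Rightarrow> 'a) \<Rightarrow> 'p atom \<Rightarrow> bool" where
  "sat_atom A e (Eq u v) = (e u = e v)"
| "sat_atom A e (TRel u v) = tr A (e u) (e v)"
| "sat_atom A e (Rel0 p) = rel0 A p"
| "sat_atom A e (Rel1 p u) = rel1 A p (e u)"
| "sat_atom A e (Rel2 p u v) = rel2 A p (e u) (e v)"

fun sat :: "('p, 'a) struct \<Rightarrow> (var \<Rightarrow> 'a) \<Rightarrow> 'p fo2 \<Rightarrow> bool" where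
  "sat A e (Atom \<alpha>) = sat_atom A e \<alpha>"
| "sat A e (Neg \<phi>) = (\<not> sat A e \<phi>)"
| "sat A e (Conj \<phi> \<psi>) = (sat A e \<phi> \<and> sat A e \<psi>)"
| "sat A e (Disj \<phi> \<psi>) = (sat A e \<phi> \<or> sat A e \<psi>)"
| "sat A e (Forall v \<phi>) = (\<forall>a\<in>univ A. sat A (e(v := a)) \<phi>)"
| "sat A e (Exists v \<phi>) = (\<exists>a\<in>univ A. sat A (e(v := a)) \<phi>)"

text \<open>\<open>holds A a b \<phi>\<close> is \<open>A \<Turnstile> \<phi>[a, b]\<close>.\<close>

definition holds :: "('p, 'a) struct \<Rightarrow> 'a \<Rightarrow> 'a \<Rightarrow> 'p fo2 \<Rightarrow> bool" where
  "holds A a b \<phi> = sat A (case_var a b) \<phi>"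

definition model :: "('p, 'a) struct \<Rightarrow> 'p fo2 \<Rightarrow> bool" where
  "model A \<Psi> \<longleftrightarrow> univ A \<noteq> {} \<and> transp_on (univ A) (tr A) \<and>
     (\<forall>a\<in>univ A. \<forall>b\<in>univ A. holds A a b \<Psi>)"

definition satisfiable :: "'a itself \<Rightarrow> 'p fo2 \<Rightarrow> bool" where
  "satisfiable _ \<Psi> \<longleftrightarrow> (\<exists>A :: ('p, 'a) struct. model A \<Psi>)"

section \<open>Types\<close>

definition literals :: "'p symb set \<Rightarrow> var set \<Rightarrow> 'p fo2 set" where
  "literals \<sigma> V = {l. \<exists>\<alpha>. atom_symbols \<alpha> \<subseteq> \<sigma> \<and> atom_vars \<alpha> \<subseteq> V \<and> (l = Atom \<alpha> \<or> l = Neg (Atom \<alpha>))}"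

definition tp1 :: "'p symb set \<Rightarrow> ('p, 'a) struct \<Rightarrow> 'a \<Rightarrow> 'p fo2 set" where
  "tp1 \<sigma> A a = {l \<in> literals \<sigma> {X}. holds A a a l}"

text \<open>For \<open>a = b\<close> this is the set of literals true of \<open>(a, a)\<close>, which contains \<open>x = y\<close>.\<close>

definition tp2 :: "'p symb set \<Rightarrow> ('p, 'a) struct \<Rightarrow> 'a \<Rightarrow> 'a \<Rightarrow> 'p fo2 set" where
  "tp2 \<sigma> A a b = {l \<in> literals \<sigma> {X, Y}. holds A a b l}"

text \<open>Semantic consequence for quantifier-free formulas in \<open>x, y\<close>. Only two elements are
  ever evaluated, so quantifying over structures on \<open>nat\<close> loses nothing.\<close>

definition entails :: "'p fo2 set \<Rightarrow> 'p fo2 \<Rightarrow> bool" where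
  "entails t \<phi> \<longleftrightarrow>
     (\<forall>(B :: ('p, nat) struct). \<forall>a\<in>univ B. \<forall>b\<in>univ B. (\<forall>l\<in>t. holds B a b l) \<longrightarrow> holds B a b \<phi>)"

section \<open>Isomorphisms, cliques, splices\<close>

definition restrict_struct :: "('p, 'a) struct \<Rightarrow> 'a set \<Rightarrow> ('p, 'a) struct" where
  "restrict_struct A B = A\<lparr>univ := B\<rparr>"

definition iso :: "'p symb set \<Rightarrow> ('a \<Rightarrow> 'b) \<Rightarrow> ('p, 'a) struct \<Rightarrow> ('p, 'b) struct \<Rightarrow> bool" where
  "iso \<sigma> f A B \<longleftrightarrow>
     bij_betw f (univ A) (univ B) \<and>
     (T \<in> \<sigma> \<longrightarrow> (\<forall>a\<in>univ A. \<forall>b\<in>univ A. tr B (f a) (f b) \<longleftrightarrow> tr A a b)) \<and>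
     (\<forall>p. P0 p \<in> \<sigma> \<longrightarrow> (rel0 B p \<longleftrightarrow> rel0 A p)) \<and>
     (\<forall>p. P1 p \<in> \<sigma> \<longrightarrow> (\<forall>a\<in>univ A. rel1 B p (f a) \<longleftrightarrow> rel1 A p a)) \<and>
     (\<forall>p. P2 p \<in> \<sigma> \<longrightarrow> (\<forall>a\<in>univ A. \<forall>b\<in>univ A. rel2 B p (f a) (f b) \<longleftrightarrow> rel2 A p a b))"

definition iso_type :: "'p symb set \<Rightarrow> ('p, 'a) struct \<Rightarrow> ('p, 'a) struct set" where
  "iso_type \<sigma> A = {B. \<exists>f. iso \<sigma> f A B}"

definition T_connected :: "('p, 'a) struct \<Rightarrow> 'a set \<Rightarrow> bool" where
  "T_connected A B \<longleftrightarrow> (\<forall>b\<in>B. \<forall>c\<in>B. b \<noteq> c \<longrightarrow> tr A b c)"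

definition clique :: "('p, 'a) struct \<Rightarrow> 'a set \<Rightarrow> bool" where
  "clique A B \<longleftrightarrow> B \<subseteq> univ A \<and> T_connected A B \<and>
     (\<forall>C. B \<subseteq> C \<and> C \<subseteq> univ A \<and> T_connected A C \<longrightarrow> C = B)"

text \<open>Well defined for \<open>a \<in> univ A\<close> when \<open>T\<close> is transitive on \<open>univ A\<close>.\<close>

definition Cl :: "('p, 'a) struct \<Rightarrow> 'a \<Rightarrow> 'a set" where
  "Cl A a = (THE B. clique A B \<and> a \<in> B)"

definition splice ::
    "'p symb set \<Rightarrow> ('p, 'a) struct \<Rightarrow> 'a set \<Rightarrow> ('p, 'a) struct set \<times> 'p fo2 set set \<times> 'p fo2 set set"
  where
  "splice \<sigma> A B =
     (iso_type \<sigma> (restrict_struct A B),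
      tp1 \<sigma> A ` {a \<in> univ A. \<forall>b\<in>B. tr A a b \<and> \<not> tr A b a},
      tp1 \<sigma> A ` {a \<in> univ A. \<forall>b\<in>B. tr A b a \<and> \<not> tr A a b})"

definition cliques_at_most :: "nat \<Rightarrow> ('p, 'a) struct \<Rightarrow> bool" where
  "cliques_at_most k A \<longleftrightarrow> (\<forall>B. clique A B \<longrightarrow> finite B \<and> card B \<le> k)"

section \<open>The bounds \<open>h\<close> and \<open>s\<close>, as functions of the size of the signature\<close>

definition exponential :: "(nat \<Rightarrow> nat) \<Rightarrow> bool" where
  "exponential f \<longleftrightarrow> (\<exists>c k. \<forall>n. f n \<le> 2 ^ (c * n ^ k + c))"

definition doubly_exponential :: "(nat \<Rightarrow> nat) \<Rightarrow> bool" where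
  "doubly_exponential f \<longleftrightarrow> (\<exists>c k. \<forall>n. f n \<le> 2 ^ (2 ^ (c * n ^ k + c)))"

definition small_clique_bound :: "'p itself \<Rightarrow> 'a itself \<Rightarrow> (nat \<Rightarrow> nat) \<Rightarrow> bool" where
  "small_clique_bound _ _ h \<longleftrightarrow>
     (\<forall>\<sigma> (\<Psi> :: 'p fo2).
        signature \<sigma> \<and> normal_form \<Psi> \<and> symbols \<Psi> \<subseteq> \<sigma> \<and> satisfiable TYPE('a) \<Psi> \<longrightarrow>
        (\<exists>A :: ('p, 'a) struct. model A \<Psi> \<and> cliques_at_most (h (card \<sigma>)) A))"

definition splice_bound :: "'p itself \<Rightarrow> 'a itself \<Rightarrow> (nat \<Rightarrow> nat) \<Rightarrow> (nat \<Rightarrow> nat) \<Rightarrow> bool" where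
  "splice_bound _ _ h s \<longleftrightarrow>
     (\<forall>\<sigma> (A :: ('p, 'a) struct).
        signature \<sigma> \<and> univ A \<noteq> {} \<and> transp_on (univ A) (tr A) \<and> cliques_at_most (h (card \<sigma>)) A \<longrightarrow>
        finite (splice \<sigma> A ` {B. clique A B}) \<and> card (splice \<sigma> A ` {B. clique A B}) \<le> s (card \<sigma>))"

section \<open>Witnesses and segments\<close>

definition W :: "('p, 'a) struct \<Rightarrow> dir \<times> 'p fo2 \<Rightarrow> 'a \<Rightarrow> 'a set" where
  "W A g a = {b \<in> univ A. b \<noteq> a \<and> holds A a b (guard_dir (fst g) (snd g))}"

text \<open>\<open>segs_via \<sigma> A f g U' V' U V\<close> says that \<open>f\<close> and \<open>g\<close> witness
  \<open>\<langle>U', V'\<rangle> \<approx> \<langle>U, V\<rangle>\<close>.\<close>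

definition segs_via ::
    "'p symb set \<Rightarrow> ('p, 'a) struct \<Rightarrow> ('a \<Rightarrow> 'a) \<Rightarrow> ('a \<Rightarrow> 'a) \<Rightarrow>
     'a set \<Rightarrow> 'a set \<Rightarrow> 'a set \<Rightarrow> 'a set \<Rightarrow> bool" where
  "segs_via \<sigma> A f g U' V' U V \<longleftrightarrow>
     U' \<inter> V' = {} \<and> U \<inter> V = {} \<and>
     iso \<sigma> f (restrict_struct A U') (restrict_struct A U) \<and>
     iso \<sigma> g (restrict_struct A V') (restrict_struct A V) \<and>
     (\<forall>b\<in>U'. \<forall>c\<in>V'. tp2 \<sigma> A b c = tp2 \<sigma> A (f b) (g c))"

text \<open>The chains
  \<open>\<langle>S\<^sub>0, S\<^sub>1\<rangle> \<approx> \<langle>S\<^sub>0, S\<^sub>2\<rangle> \<approx> \<langle>S\<^sub>0, S\<^sub>3\<rangle>\<close> and \<open>\<langle>S\<^sub>1, S\<^sub>2\<rangle> \<approx> \<langle>S\<^sub>2, S\<^sub>3\<rangle> \<approx> \<langle>S\<^sub>1, S\<^sub>3\<rangle>\<close>.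
  The isomorphisms are those of one identification \<open>S\<^sub>1 \<rightarrow> S\<^sub>2 \<rightarrow> S\<^sub>3\<close> of the segments, with \<open>S\<^sub>0\<close> fixed
  pointwise. This coherence cannot be dropped: if each \<open>\<approx>\<close> may use its own isomorphisms
  (twisted by automorphisms of the segments), the finite structure need not extend to an infinite
  sequence of segments with transitive \<open>T\<close>, and there are unsatisfiable sentences for which such a
  finite structure exists.\<close>

definition similar_segments ::
    "'p symb set \<Rightarrow> ('p, 'a) struct \<Rightarrow> (nat \<Rightarrow> 'a set) \<Rightarrow> bool" where
  "similar_segments \<sigma> A S \<longleftrightarrow>
     (\<exists>f g.
        segs_via \<sigma> A id f (S 0) (S 1) (S 0) (S 2) \<and>
        segs_via \<sigma> A id g (S 0) (S 2) (S 0) (S 3) \<and>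
        segs_via \<sigma> A f g (S 1) (S 2) (S 2) (S 3) \<and>
        segs_via \<sigma> A f id (S 1) (S 3) (S 2) (S 3))"

end

theory Submission
  imports Defs "HOL-Library.Countable_Set"
begin

text \<open>From the four segments one builds a model with segments \<open>S 0, S 1, S 1, S 1, \<dots>\<close>, any two copies
  of \<open>S 1\<close> being related like \<open>S 1\<close> and \<open>S 2\<close>: every element of a copy finds its witnesses in \<open>S 0\<close>
  or in the next copy.

  Conversely, let \<open>A\<close> be a model with small cliques. Clique \<open>C\<close> may be placed below clique \<open>D\<close>, with
  2-types borrowed from \<open>A\<close>, whenever the 1-types in and above \<open>D\<close> occur above \<open>C\<close> and those in
  and below \<open>C\<close> occur below \<open>D\<close>. This transitive relation depends only on the splices of \<open>C\<close> and \<open>D\<close> and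
  extends the order of \<open>A\<close>, so the order of \<open>A\<close> can be replaced by it, each class of mutually
  comparable splices being ordered linearly in an arbitrary way. A clique cannot be duplicated only if it is
  the only one with its splice and is not below itself (a royal clique). \<open>S 0\<close> consists of the royal
  cliques, the cliques of their witnesses and one further clique; every other \<open>S j\<close> has \<open>m + 1\<close>
  copies of a representative of each non-royal splice, copy \<open>i\<close> providing witnesses for the
  \<open>i\<close>-th formula to elements of all earlier segments. There are at most \<open>s\<close> royal cliques,
  with at most \<open>m * h\<close> witnesses each, and the bound on \<open>S 0\<close> follows from \<open>h \<le> s\<close>.\<close>

section \<open>Types and quantifier-free formulas\<close>

lemma tp1_eq_iff:
  "tp1 \<sigma> A a = tp1 \<sigma> B c \<longleftrightarrow>
     (T \<in> \<sigma> \<longrightarrow> tr A a a = tr B c c) \<and> (\<forall>p. P0 p \<in> \<sigma> \<longrightarrow> rel0 A p = rel0 B p) \<and>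
     (\<forall>p. P1 p \<in> \<sigma> \<longrightarrow> rel1 A p a = rel1 B p c) \<and>
     (\<forall>p. P2 p \<in> \<sigma> \<longrightarrow> rel2 A p a a = rel2 B p c c)" (is "?L \<longleftrightarrow> ?R")
proof
  assume L: ?L
  have atom: "sat_atom A (case_var a a) \<alpha> = sat_atom B (case_var c c) \<alpha>"
    if "atom_symbols \<alpha> \<subseteq> \<sigma>" "atom_vars \<alpha> \<subseteq> {X}" for \<alpha>
  proof -
    have "Atom \<alpha> \<in> tp1 \<sigma> A a \<longleftrightarrow> Atom \<alpha> \<in> tp1 \<sigma> B c"
      using L by simp
    then show ?thesis
      using that by (auto simp: tp1_def literals_def holds_def)
  qed
  have "tr A a a = tr B c c" if "T \<in> \<sigma>"
    using atom[of "TRel X X"] that by simp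
  moreover have "rel0 A p = rel0 B p" if "P0 p \<in> \<sigma>" for p
    using atom[of "Rel0 p"] that by simp
  moreover have "rel1 A p a = rel1 B p c" if "P1 p \<in> \<sigma>" for p
    using atom[of "Rel1 p X"] that by simp
  moreover have "rel2 A p a a = rel2 B p c c" if "P2 p \<in> \<sigma>" for p
    using atom[of "Rel2 p X X"] that by simp
  ultimately show ?R
    by blast
next
  assume R: ?R
  have "sat_atom A (case_var a a) \<alpha> = sat_atom B (case_var c c) \<alpha>"
    if "atom_symbols \<alpha> \<subseteq> \<sigma>" "atom_vars \<alpha> \<subseteq> {X}" for \<alpha>
    using that R by (cases \<alpha>) auto
  then show ?L
    by (auto simp: tp1_def literals_def holds_def)
qed

lemma tp2_eq_iff_atoms:
  fixes \<sigma> :: "'p symb set"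
  shows "tp2 \<sigma> A a b = tp2 \<sigma> B c d \<longleftrightarrow>
     (\<forall>\<alpha>. atom_symbols \<alpha> \<subseteq> \<sigma> \<longrightarrow> sat_atom A (case_var a b) \<alpha> = sat_atom B (case_var c d) \<alpha>)"
proof -
  have vars: "atom_vars \<alpha> \<subseteq> {X, Y}" for \<alpha> :: "'p atom"
    using var.exhaust by blast
  have "sat_atom A (case_var a b) \<alpha> = sat_atom B (case_var c d) \<alpha>"
    if eq: "tp2 \<sigma> A a b = tp2 \<sigma> B c d" and \<alpha>: "atom_symbols \<alpha> \<subseteq> \<sigma>" for \<alpha>
  proof -
    have "Atom \<alpha> \<in> tp2 \<sigma> A a b \<longleftrightarrow> Atom \<alpha> \<in> tp2 \<sigma> B c d"
      using eq by simp
    then show ?thesis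
      using \<alpha> vars[of \<alpha>] by (auto simp: tp2_def literals_def holds_def)
  qed
  then show ?thesis
    by (auto simp: tp2_def literals_def holds_def)
qed

text \<open>With \<open>tp1_eq_iff\<close>, this replaces equality of sets of literals by agreement
  of atomic data, which can be split and recombined symbol by symbol.\<close>

lemma tp2_eq_iff:
  "tp2 \<sigma> A a b = tp2 \<sigma> B c d \<longleftrightarrow>
     (a = b \<longleftrightarrow> c = d) \<and> tp1 \<sigma> A a = tp1 \<sigma> B c \<and> tp1 \<sigma> A b = tp1 \<sigma> B d \<and>
     (T \<in> \<sigma> \<longrightarrow> tr A a b = tr B c d \<and> tr A b a = tr B d c) \<and>
     (\<forall>p. P2 p \<in> \<sigma> \<longrightarrow> rel2 A p a b = rel2 B p c d \<and> rel2 A p b a = rel2 B p d c)"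
    (is "?L \<longleftrightarrow> ?R")
proof
  assume ?L
  then have atom: "atom_symbols \<alpha> \<subseteq> \<sigma> \<Longrightarrow>
      sat_atom A (case_var a b) \<alpha> = sat_atom B (case_var c d) \<alpha>" for \<alpha>
    by (simp add: tp2_eq_iff_atoms)
  have "a = b \<longleftrightarrow> c = d"
    using atom[of "Eq X Y"] by simp
  moreover have "tr A a a = tr B c c \<and> tr A b b = tr B d d \<and> tr A a b = tr B c d \<and> tr A b a = tr B d c"
    if "T \<in> \<sigma>"
    using that atom[of "TRel X X"] atom[of "TRel Y Y"] atom[of "TRel X Y"] atom[of "TRel Y X"] by simp
  moreover have "rel0 A p = rel0 B p" if "P0 p \<in> \<sigma>" for p
    using atom[of "Rel0 p"] that by simp
  moreover have "rel1 A p a = rel1 B p c \<and> rel1 A p b = rel1 B p d" if "P1 p \<in> \<sigma>" for p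
    using atom[of "Rel1 p X"] atom[of "Rel1 p Y"] that by simp
  moreover have "rel2 A p a a = rel2 B p c c \<and> rel2 A p b b = rel2 B p d d \<and>
      rel2 A p a b = rel2 B p c d \<and> rel2 A p b a = rel2 B p d c" if "P2 p \<in> \<sigma>" for p
    using that atom[of "Rel2 p X X"] atom[of "Rel2 p Y Y"] atom[of "Rel2 p X Y"] atom[of "Rel2 p Y X"]
    by simp
  ultimately show ?R
    unfolding tp1_eq_iff by blast
next
  assume R: ?R
  have "sat_atom A (case_var a b) \<alpha> = sat_atom B (case_var c d) \<alpha>"
    if "atom_symbols \<alpha> \<subseteq> \<sigma>" for \<alpha>
  proof (cases \<alpha>)
    case (Eq u v)
    then show ?thesis using R by (cases u; cases v) auto
  next
    case (TRel u v)
    then show ?thesis using R that by (cases u; cases v) (simp_all add: tp1_eq_iff)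
  next
    case (Rel0 p)
    then show ?thesis using R that by (simp add: tp1_eq_iff)
  next
    case (Rel1 p u)
    then show ?thesis using R that by (cases u) (simp_all add: tp1_eq_iff)
  next
    case (Rel2 p u v)
    then show ?thesis using R that by (cases u; cases v) (simp_all add: tp1_eq_iff)
  qed
  then show ?L
    by (simp add: tp2_eq_iff_atoms)
qed

lemma tp2_eq_commute: "tp2 \<sigma> A a b = tp2 \<sigma> B c d \<Longrightarrow> tp2 \<sigma> A b a = tp2 \<sigma> B d c"
  by (auto simp: tp2_eq_iff)

lemma holds_cong_tp2:
  assumes "tp2 \<sigma> A a b = tp2 \<sigma> B c d" "quantifier_free \<phi>" "symbols \<phi> \<subseteq> \<sigma>"
  shows "holds A a b \<phi> = holds B c d \<phi>"
  using assms(2,3)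
proof (induction \<phi>)
  case (Atom \<alpha>)
  then show ?case
    using assms(1) by (simp add: tp2_eq_iff_atoms holds_def)
qed (auto simp: holds_def)

text \<open>A 2-type contains each atom over \<sigma> or its negation, so a pair satisfying all its
  literals can have no other type.\<close>

lemma tp2_eqI_literals:
  fixes \<sigma> :: "'p symb set"
  assumes "\<forall>l\<in>tp2 \<sigma> A a b. holds B c d l"
  shows "tp2 \<sigma> A a b = tp2 \<sigma> B c d"
  unfolding tp2_eq_iff_atoms
proof (intro allI impI)
  fix \<alpha> :: "'p atom"
  assume \<alpha>: "atom_symbols \<alpha> \<subseteq> \<sigma>"
  have "atom_vars \<alpha> \<subseteq> {X, Y}"
    using var.exhaust by blast
  with \<alpha> have "Atom \<alpha> \<in> literals \<sigma> {X, Y}" "Neg (Atom \<alpha>) \<in> literals \<sigma> {X, Y}"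
    by (auto simp: literals_def)
  then show "sat_atom A (case_var a b) \<alpha> = sat_atom B (case_var c d) \<alpha>"
    using assms by (fastforce simp: tp2_def holds_def)
qed

lemma entails_tp2_iff:
  assumes "quantifier_free \<phi>" "symbols \<phi> \<subseteq> \<sigma>"
  shows "entails (tp2 \<sigma> A a b) \<phi> \<longleftrightarrow> holds A a b \<phi>"
proof
  assume "holds A a b \<phi>"
  then show "entails (tp2 \<sigma> A a b) \<phi>"
    unfolding entails_def by (metis holds_cong_tp2[OF _ assms] tp2_eqI_literals)
next
  assume ent: "entails (tp2 \<sigma> A a b) \<phi>"
  \<comment> \<open>The pair is copied into a structure on \<open>nat\<close>, with 0 and 1 in the
    roles of \<open>a\<close> and \<open>b\<close>. If \<open>a = b\<close>, the second component
    must be 0 again, because the 2-type then contains the literal \<open>x = y\<close>.\<close>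
  define e where "e = (\<lambda>n::nat. if n = 0 then a else b)"
  define c where "c = (if a = b then 0 else 1 :: nat)"
  define B where "B = \<lparr>univ = {0, 1}, tr = \<lambda>m n. tr A (e m) (e n), rel0 = rel0 A,
      rel1 = \<lambda>p n. rel1 A p (e n), rel2 = \<lambda>p m n. rel2 A p (e m) (e n)\<rparr>"
  have eq: "tp2 \<sigma> A a b = tp2 \<sigma> B 0 c"
    by (auto simp: tp2_eq_iff tp1_eq_iff B_def e_def c_def)
  then have "\<forall>l\<in>tp2 \<sigma> A a b. holds B 0 c l"
    by (auto simp: tp2_def)
  moreover have "0 \<in> univ B" "c \<in> univ B"
    by (auto simp: B_def c_def)
  ultimately have "holds B 0 c \<phi>"
    using ent unfolding entails_def by blast
  then show "holds A a b \<phi>"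
    using holds_cong_tp2[OF eq assms] by simp
qed

lemma iso_tp2:
  assumes "iso \<sigma> f (restrict_struct A U) (restrict_struct A V)" "a \<in> U" "b \<in> U"
  shows "tp2 \<sigma> A (f a) (f b) = tp2 \<sigma> A a b"
proof -
  have "inj_on f U"
    using assms(1) by (simp add: iso_def restrict_struct_def bij_betw_def)
  then have "f a = f b \<longleftrightarrow> a = b"
    using assms(2,3) by (auto dest: inj_onD)
  then show ?thesis
    using assms by (auto simp: iso_def restrict_struct_def tp2_eq_iff tp1_eq_iff)
qed

text \<open>A structure on \<open>U\<close> all of whose 2-types are borrowed from \<open>A\<close>:
  \<open>src x y\<close> is the element of \<open>A\<close> that stands for \<open>x\<close> when
  \<open>x\<close> is related to \<open>y\<close>. Both the infinite unfolding and the small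
  segmented structure have this form.\<close>

definition weave :: "('p, 'a) struct \<Rightarrow> 'u set \<Rightarrow> ('u \<Rightarrow> 'u \<Rightarrow> 'a) \<Rightarrow> ('p, 'u) struct" where
  "weave A U src = \<lparr>univ = U, tr = \<lambda>x y. tr A (src x y) (src y x), rel0 = rel0 A,
     rel1 = \<lambda>p x. rel1 A p (src x x), rel2 = \<lambda>p x y. rel2 A p (src x y) (src y x)\<rparr>"

text \<open>1-types of the weave are read off the diagonal of \<open>src\<close>, so the first two
  premises make borrowed pairs compatible with them; the third does the same for the equality
  literal.\<close>

lemma tp2_weave:
  assumes "tp1 \<sigma> A (src x y) = tp1 \<sigma> A (src x x)" "tp1 \<sigma> A (src y x) = tp1 \<sigma> A (src y y)"
    and "src x y = src y x \<longleftrightarrow> x = y"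
  shows "tp2 \<sigma> (weave A U src) x y = tp2 \<sigma> A (src x y) (src y x)"
proof -
  have "tp1 \<sigma> (weave A U src) z = tp1 \<sigma> A (src z z)" for z
    by (simp add: tp1_eq_iff weave_def)
  then show ?thesis
    using assms by (simp add: tp2_eq_iff weave_def)
qed

lemma iso_restrictI:
  assumes "bij_betw f U V" "\<And>a b. a \<in> U \<Longrightarrow> b \<in> U \<Longrightarrow> tp2 \<sigma> A (f a) (f b) = tp2 \<sigma> A a b"
  shows "iso \<sigma> f (restrict_struct A U) (restrict_struct A V)"
  using assms by (simp add: iso_def restrict_struct_def tp2_eq_iff tp1_eq_iff)

section \<open>Normal-form sentences\<close>

lemma sat_foldl_Conj: "sat A e (foldl Conj \<phi> \<phi>s) \<longleftrightarrow> sat A e \<phi> \<and> (\<forall>\<psi>\<in>set \<phi>s. sat A e \<psi>)"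
  by (induction \<phi>s arbitrary: \<phi>) auto

lemma symbols_foldl_Conj: "symbols (foldl Conj \<phi> \<phi>s) = symbols \<phi> \<union> (\<Union>\<psi>\<in>set \<phi>s. symbols \<psi>)"
  by (induction \<phi>s arbitrary: \<phi>) auto

lemma finite_symbols: "finite (symbols \<phi>)"
proof (induction \<phi>)
  case (Atom \<alpha>)
  then show ?case by (cases \<alpha>) auto
qed auto

lemma case_var_fun_upd: "e(X := a, Y := b) = case_var a b"
  by (auto simp: fun_eq_iff split: var.split)

lemma quantifier_free_guard_dir: "quantifier_free (guard_dir d \<psi>) = quantifier_free \<psi>"
  by (cases d) auto

lemma holds_guard_dir:
  "holds A a b (guard_dir d \<psi>) \<longleftrightarrow>
     (if d = Fwd then tr A a b \<and> \<not> tr A b a else \<not> tr A a b \<and> tr A b a) \<and> holds A a b \<psi>"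
  by (cases d) (auto simp: holds_def)

lemma holds_guard_both:
  "holds A a b (guard_both \<psi>) \<longleftrightarrow> tr A a b \<and> tr A b a \<and> holds A a b \<psi>"
  by (auto simp: holds_def guard_both_def)

lemma model_normal_sentence_iff:
  "model A (normal_sentence \<psi>0 gs ds) \<longleftrightarrow>
     univ A \<noteq> {} \<and> transp_on (univ A) (tr A) \<and>
     (\<forall>a\<in>univ A. \<forall>b\<in>univ A. holds A a b \<psi>0) \<and>
     (\<forall>a\<in>univ A. \<forall>i<length gs. \<exists>b\<in>univ A. holds A a b (guard_dir (fst (gs ! i)) (snd (gs ! i)))) \<and>
     (\<forall>a\<in>univ A. \<forall>i<length ds. \<exists>b\<in>univ A. holds A a b (guard_both (ds ! i)))"
proof -
  have "holds A a b (normal_sentence \<psi>0 gs ds) \<longleftrightarrow>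
      (\<forall>a\<in>univ A. \<forall>b\<in>univ A. holds A a b \<psi>0) \<and>
      (\<forall>g\<in>set gs. \<forall>a\<in>univ A. \<exists>b\<in>univ A. holds A a b (guard_dir (fst g) (snd g))) \<and>
      (\<forall>\<psi>\<in>set ds. \<forall>a\<in>univ A. \<exists>b\<in>univ A. holds A a b (guard_both \<psi>))" for a b
    by (auto simp: holds_def normal_sentence_def sat_foldl_Conj case_var_fun_upd)
  then show ?thesis
    unfolding model_def all_set_conv_all_nth by blast
qed

lemma symbols_normal_sentence:
  "symbols (normal_sentence \<psi>0 gs ds) =
     symbols \<psi>0 \<union> (\<Union>g\<in>set gs. symbols (guard_dir (fst g) (snd g))) \<union>
     (\<Union>\<psi>\<in>set ds. symbols (guard_both \<psi>))"
  by (auto simp: normal_sentence_def symbols_foldl_Conj split: prod.splits)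

lemma normal_data_components:
  assumes "normal_data \<psi>0 gs ds" "symbols (normal_sentence \<psi>0 gs ds) \<subseteq> \<sigma>"
  shows "quantifier_free \<psi>0" "symbols \<psi>0 \<subseteq> \<sigma>"
    and "i < length gs \<Longrightarrow> quantifier_free (guard_dir (fst (gs ! i)) (snd (gs ! i)))"
    and "i < length gs \<Longrightarrow> symbols (guard_dir (fst (gs ! i)) (snd (gs ! i))) \<subseteq> \<sigma>"
    and "j < length ds \<Longrightarrow> quantifier_free (guard_both (ds ! j))"
    and "j < length ds \<Longrightarrow> symbols (guard_both (ds ! j)) \<subseteq> \<sigma>"
proof -
  show "quantifier_free \<psi>0" "symbols \<psi>0 \<subseteq> \<sigma>"
    using assms by (auto simp: normal_data_def symbols_normal_sentence)
  show "quantifier_free (guard_dir (fst (gs ! i)) (snd (gs ! i)))"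
    and "symbols (guard_dir (fst (gs ! i)) (snd (gs ! i))) \<subseteq> \<sigma>" if "i < length gs"
  proof -
    have "gs ! i \<in> set gs"
      using that by simp
    then show "quantifier_free (guard_dir (fst (gs ! i)) (snd (gs ! i)))"
      and "symbols (guard_dir (fst (gs ! i)) (snd (gs ! i))) \<subseteq> \<sigma>"
      using assms unfolding normal_data_def symbols_normal_sentence quantifier_free_guard_dir
      by (fastforce, blast)
  qed
  show "quantifier_free (guard_both (ds ! j))" and "symbols (guard_both (ds ! j)) \<subseteq> \<sigma>"
    if "j < length ds"
  proof -
    have "ds ! j \<in> set ds"
      using that by simp
    then show "quantifier_free (guard_both (ds ! j))" and "symbols (guard_both (ds ! j)) \<subseteq> \<sigma>"
      using assms unfolding normal_data_def symbols_normal_sentence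
      by (simp add: guard_both_def, blast)
  qed
qed

section \<open>Cliques\<close>

text \<open>An explicit form of \<open>Cl\<close> without definite description. The disjunct
  \<open>b = a\<close> is there because \<open>T\<close> may be irreflexive at
  \<open>a\<close>.\<close>

definition cl :: "('p, 'a) struct \<Rightarrow> 'a \<Rightarrow> 'a set" where
  "cl A a = {b \<in> univ A. b = a \<or> tr A a b \<and> tr A b a}"

lemma self_in_cl: "a \<in> univ A \<Longrightarrow> a \<in> cl A a"
  by (simp add: cl_def)

lemma cl_eq:
  assumes "transp_on (univ A) (tr A)" "a \<in> univ A" "b \<in> cl A a"
  shows "cl A b = cl A a"
proof -
  have b: "b \<in> univ A" "b = a \<or> tr A a b \<and> tr A b a"
    using assms(3) by (auto simp: cl_def)
  have trans: "tr A x y \<Longrightarrow> tr A y z \<Longrightarrow> tr A x z"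
    if "x \<in> univ A" "y \<in> univ A" "z \<in> univ A" for x y z
    using transp_onD[OF assms(1)] that by blast
  have "c \<in> cl A b \<longleftrightarrow> c \<in> cl A a" if "c \<in> univ A" for c
    using b(2) trans[OF that b(1) assms(2)] trans[OF that assms(2) b(1)]
      trans[OF assms(2) b(1) that] trans[OF b(1) assms(2) that] \<open>b \<in> univ A\<close> assms(2) that
    unfolding cl_def mem_Collect_eq by blast
  then show ?thesis
    by (auto simp: cl_def)
qed

lemma clique_cl:
  assumes tr: "transp_on (univ A) (tr A)" and a: "a \<in> univ A"
  shows "clique A (cl A a)"
proof -
  have "T_connected A (cl A a)"
    unfolding T_connected_def
  proof (intro ballI impI)
    fix b c
    assume "b \<in> cl A a" "c \<in> cl A a" "b \<noteq> c"
    then have "c \<in> cl A b" "b \<noteq> c"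
      using cl_eq[OF assms] by auto
    then show "tr A b c"
      by (auto simp: cl_def)
  qed
  moreover have "C = cl A a" if C: "cl A a \<subseteq> C" "C \<subseteq> univ A" "T_connected A C" for C
  proof -
    have "a \<in> C"
      using C(1) self_in_cl[OF a] by auto
    then have "c = a \<or> tr A a c \<and> tr A c a" if "c \<in> C" for c
      using that C(3) by (metis T_connected_def)
    then have "C \<subseteq> cl A a"
      using C(2) by (auto simp: cl_def)
    then show ?thesis
      using C(1) by auto
  qed
  moreover have "cl A a \<subseteq> univ A"
    by (auto simp: cl_def)
  ultimately show ?thesis
    unfolding clique_def by blast
qed

lemma clique_eq_cl:
  assumes tr: "transp_on (univ A) (tr A)" and B: "clique A B" "a \<in> B"
  shows "B = cl A a"
proof -
  have a: "a \<in> univ A" and con: "T_connected A B" and sub: "B \<subseteq> univ A"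
    using B by (auto simp: clique_def)
  have "c = a \<or> tr A a c \<and> tr A c a" if "c \<in> B" for c
    using con that B(2) by (metis T_connected_def)
  then have "B \<subseteq> cl A a"
    using sub by (auto simp: cl_def)
  then show ?thesis
    using B(1) clique_cl[OF tr a] unfolding clique_def by auto
qed

lemma Cl_eq_cl:
  assumes "transp_on (univ A) (tr A)" "a \<in> univ A"
  shows "Cl A a = cl A a"
  unfolding Cl_def
proof (rule the_equality)
  show "clique A (cl A a) \<and> a \<in> cl A a"
    using clique_cl[OF assms] self_in_cl[OF assms(2)] ..
  show "B = cl A a" if "clique A B \<and> a \<in> B" for B
    using clique_eq_cl[OF assms(1)] that by blast
qed

section \<open>Unfolding four segments to infinitely many\<close>

text \<open>The unfolding has one copy of \<open>S 0\<close> and copies of \<open>S 1\<close>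
  numbered from 1 on. Its elements form an arbitrary set \<open>U\<close> labelled by
  \<open>seg\<close> and \<open>org\<close>, so that \<open>U\<close> can later be chosen inside the
  type of \<open>A\<close>.\<close>

locale unfolding_segments =
  fixes A :: "('p, 'a) struct" and \<sigma> :: "'p symb set" and S :: "nat \<Rightarrow> 'a set"
    and f g :: "'a \<Rightarrow> 'a" and U :: "'u set" and seg :: "'u \<Rightarrow> nat" and org :: "'u \<Rightarrow> 'a"
  assumes univ_A: "univ A = S 0 \<union> S 1 \<union> S 2 \<union> S 3"
    and trans_A: "transp_on (univ A) (tr A)"
    and T_in_\<sigma>: "T \<in> \<sigma>"
    and via01: "segs_via \<sigma> A id f (S 0) (S 1) (S 0) (S 2)"
    and via02: "segs_via \<sigma> A id g (S 0) (S 2) (S 0) (S 3)"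
    and via12: "segs_via \<sigma> A f g (S 1) (S 2) (S 2) (S 3)"
    and via13: "segs_via \<sigma> A f id (S 1) (S 3) (S 2) (S 3)"
    and decode: "bij_betw (\<lambda>u. (seg u, org u)) U ({0} \<times> S 0 \<union> {1..} \<times> S 1)"
begin

definition part :: "nat \<Rightarrow> 'a set" where
  "part n = (if n = 0 then S 0 else S 1)"

text \<open>Carries an origin in \<open>part n\<close> to its counterpart in the segment
  \<open>S n\<close> of \<open>A\<close>; meant for \<open>n \<le> 3\<close>.\<close>

definition shift :: "nat \<Rightarrow> 'a \<Rightarrow> 'a" where
  "shift n = (if n \<le> 1 then id else if n = 2 then f else g \<circ> f)"

text \<open>Segments \<open>0 < m < n\<close> of the unfolding are related like \<open>S 1\<close> and \<open>S 2\<close>.\<close>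

definition src :: "'u \<Rightarrow> 'u \<Rightarrow> 'a" where
  "src x y = (if 0 < seg y \<and> seg y < seg x then f (org x) else org x)"

abbreviation unrolled :: "('p, 'u) struct" where
  "unrolled \<equiv> weave A U src"

lemma iso_f: "iso \<sigma> f (restrict_struct A (S 1)) (restrict_struct A (S 2))"
  and iso_g: "iso \<sigma> g (restrict_struct A (S 2)) (restrict_struct A (S 3))"
  using via12 by (auto simp: segs_via_def)

lemma f_image: "f ` S 1 = S 2" and g_image: "g ` S 2 = S 3"
  using iso_f iso_g by (auto simp: iso_def restrict_struct_def bij_betw_def)

lemma f_in: "a \<in> S 1 \<Longrightarrow> f a \<in> S 2" and g_in: "a \<in> S 2 \<Longrightarrow> g a \<in> S 3"
  using f_image g_image by blast+

lemma disjoint: "i \<le> 3 \<Longrightarrow> j \<le> 3 \<Longrightarrow> i \<noteq> j \<Longrightarrow> S i \<inter> S j = {}"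
proof -
  have "S 0 \<inter> S 1 = {}" "S 0 \<inter> S 2 = {}" "S 0 \<inter> S 3 = {}" "S 1 \<inter> S 2 = {}" "S 1 \<inter> S 3 = {}" "S 2 \<inter> S 3 = {}"
    using via01 via02 via12 via13 by (auto simp: segs_via_def)
  moreover assume "i \<le> 3" "j \<le> 3" "i \<noteq> j"
  then have "i \<in> {0, 1, 2, 3}" "j \<in> {0, 1, 2, 3}"
    by auto
  ultimately show ?thesis
    using \<open>i \<noteq> j\<close> by (auto simp: Int_commute)
qed

lemma shift_in: "n \<le> 3 \<Longrightarrow> a \<in> part n \<Longrightarrow> shift n a \<in> S n"
proof -
  assume "n \<le> 3" "a \<in> part n"
  moreover from \<open>n \<le> 3\<close> have "n \<in> {0, 1, 2, 3}"
    by auto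
  ultimately show ?thesis
    using f_in[of a] g_in[of "f a"] by (auto simp: part_def shift_def)
qed

lemma tp2_shift_same:
  assumes "n \<le> 3" "a \<in> part n" "b \<in> part n"
  shows "tp2 \<sigma> A (shift n a) (shift n b) = tp2 \<sigma> A a b"
proof -
  consider "n \<le> 1" | "n = 2" | "n = 3"
    using assms(1) by linarith
  then show ?thesis
  proof cases
    case 3
    then have ab: "a \<in> S 1" "b \<in> S 1"
      using assms by (auto simp: part_def)
    then have "f a \<in> S 2" "f b \<in> S 2"
      by (simp_all only: f_in)
    then show ?thesis
      using 3 iso_tp2[OF iso_g] iso_tp2[OF iso_f] ab by (simp add: shift_def)
  qed (use assms iso_tp2[OF iso_f] in \<open>auto simp: shift_def part_def\<close>)
qed

text \<open>Here the coherence of the isomorphisms enters: since the same \<open>f\<close> and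
  \<open>g\<close> occur in all four similarities, each of the six pairs of distinct segments can be
  carried back to \<open>S 0\<close>, \<open>S 1\<close> or to \<open>S 1\<close>,
  \<open>S 2\<close>.\<close>

lemma tp2_shift_less:
  assumes "m < n" "n \<le> 3" "a \<in> part m" "b \<in> part n"
  shows "tp2 \<sigma> A (shift m a) (shift n b) = tp2 \<sigma> A a (if 0 < m then f b else b)"
proof -
  have b: "b \<in> S 1" "f b \<in> S 2" "g (f b) \<in> S 3"
    using assms f_in[of b] g_in[of "f b"] by (auto simp: part_def)
  have v01: "x \<in> S 0 \<Longrightarrow> y \<in> S 1 \<Longrightarrow> tp2 \<sigma> A x y = tp2 \<sigma> A x (f y)"
    and v02: "x \<in> S 0 \<Longrightarrow> y \<in> S 2 \<Longrightarrow> tp2 \<sigma> A x y = tp2 \<sigma> A x (g y)"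
    and v12: "x \<in> S 1 \<Longrightarrow> y \<in> S 2 \<Longrightarrow> tp2 \<sigma> A x y = tp2 \<sigma> A (f x) (g y)"
    and v13: "x \<in> S 1 \<Longrightarrow> y \<in> S 3 \<Longrightarrow> tp2 \<sigma> A x y = tp2 \<sigma> A (f x) y" for x y
    using via01 via02 via12 via13 by (auto simp: segs_via_def)
  consider "m = 0" "n = 1" | "m = 0" "n = 2" | "m = 0" "n = 3" | "m = 1" "n = 2"
    | "m = 1" "n = 3" | "m = 2" "n = 3"
    using assms(1,2) by linarith
  then show ?thesis
  proof cases
    case 1
    then show ?thesis by (simp add: shift_def)
  next
    case 2
    then show ?thesis using assms b v01 by (simp add: shift_def part_def)
  next
    case 3
    then have "a \<in> S 0"
      using assms by (simp add: part_def)
    then show ?thesis using 3 b v01[of a b] v02[of a "f b"] by (simp add: shift_def)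
  next
    case 4
    then show ?thesis by (simp add: shift_def)
  next
    case 5
    then have "a \<in> S 1"
      using assms by (simp add: part_def)
    then show ?thesis using 5 b v13[of a "g (f b)"] v12[of a "f b"] by (simp add: shift_def)
  next
    case 6
    then have "a \<in> S 1"
      using assms by (simp add: part_def)
    then show ?thesis using 6 b v12[of a "f b"] by (simp add: shift_def)
  qed
qed

lemma org_in: "x \<in> U \<Longrightarrow> org x \<in> part (seg x)"
  using bij_betwE[OF decode] by (fastforce simp: part_def)

lemma org_inj: "x \<in> U \<Longrightarrow> y \<in> U \<Longrightarrow> seg x = seg y \<Longrightarrow> org x = org y \<Longrightarrow> x = y"
  using decode by (auto simp: bij_betw_def dest: inj_onD)

lemma obtain_decode:
  assumes "a \<in> part n"
  obtains u where "u \<in> U" "seg u = n" "org u = a"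
proof -
  have "(n, a) \<in> (\<lambda>u. (seg u, org u)) ` U"
    using decode assms by (auto simp: bij_betw_def part_def split: if_splits)
  then show ?thesis
    using that by auto
qed

lemma src_in: "x \<in> U \<Longrightarrow> src x y \<in> univ A"
  using org_in[of x] f_in[of "org x"] univ_A by (auto simp: src_def part_def split: if_splits)

lemma tp1_src:
  assumes "x \<in> U"
  shows "tp1 \<sigma> A (src x y) = tp1 \<sigma> A (org x)"
proof (cases "0 < seg y \<and> seg y < seg x")
  case True
  then have "org x \<in> S 1"
    using org_in[OF assms] by (simp add: part_def)
  then have "tp2 \<sigma> A (f (org x)) (f (org x)) = tp2 \<sigma> A (org x) (org x)"
    by (intro iso_tp2[OF iso_f])
  then show ?thesis
    using True by (simp add: src_def tp2_eq_iff)
next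
  case False
  then show ?thesis
    unfolding src_def by auto
qed

text \<open>For elements of different segments the two sources lie in different members of the
  disjoint family \<open>S 0\<close>, \<open>S 1\<close>, \<open>S 2\<close>; inside one segment the
  labels decide.\<close>

lemma src_eq_iff:
  assumes "x \<in> U" "y \<in> U"
  shows "src x y = src y x \<longleftrightarrow> x = y"
proof
  assume eq: "src x y = src y x"
  have d: "S 0 \<inter> S 1 = {}" "S 0 \<inter> S 2 = {}" "S 1 \<inter> S 2 = {}"
    using disjoint by auto
  have "seg x = seg y"
  proof (rule ccontr)
    assume "seg x \<noteq> seg y"
    then show False
      using eq org_in[OF assms(1)] org_in[OF assms(2)] d f_in[of "org x"] f_in[of "org y"]
      by (auto simp: src_def part_def split: if_splits)
  qed
  then show "x = y"
    using eq assms org_inj by (auto simp: src_def)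
qed simp

lemma tp2_unrolled:
  assumes "x \<in> U" "y \<in> U"
  shows "tp2 \<sigma> unrolled x y = tp2 \<sigma> A (src x y) (src y x)"
proof (rule tp2_weave)
  show "tp1 \<sigma> A (src x y) = tp1 \<sigma> A (src x x)" "tp1 \<sigma> A (src y x) = tp1 \<sigma> A (src y y)"
    using tp1_src assms by simp_all
qed (rule src_eq_iff[OF assms])

text \<open>2-types in the unfolding depend on segment numbers only through their order and through
  which are 0. So any renumbering \<open>\<rho>\<close> that respects these folds the pair back into
  the four segments of \<open>A\<close>.\<close>

lemma tp2_unrolled_shift:
  assumes xy: "x \<in> U" "y \<in> U"
    and \<rho>: "\<rho> (seg x) \<le> 3" "\<rho> (seg y) \<le> 3" "\<And>n. \<rho> n = 0 \<longleftrightarrow> n = 0"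
    and mono: "\<rho> (seg x) < \<rho> (seg y) \<longleftrightarrow> seg x < seg y" "\<rho> (seg y) < \<rho> (seg x) \<longleftrightarrow> seg y < seg x"
  shows "tp2 \<sigma> unrolled x y =
    tp2 \<sigma> A (shift (\<rho> (seg x)) (org x)) (shift (\<rho> (seg y)) (org y))"
proof -
  have part: "org x \<in> part (\<rho> (seg x))" "org y \<in> part (\<rho> (seg y))"
    using org_in xy \<rho>(3) by (auto simp: part_def)
  consider "seg x = seg y" | "seg x < seg y" | "seg y < seg x"
    by linarith
  then show ?thesis
  proof cases
    case 1
    then show ?thesis
      using tp2_shift_same part \<rho> by (simp add: tp2_unrolled xy src_def)
  next
    case 2
    then have "tp2 \<sigma> A (shift (\<rho> (seg x)) (org x)) (shift (\<rho> (seg y)) (org y)) =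
        tp2 \<sigma> A (org x) (if 0 < seg x then f (org y) else org y)"
      using tp2_shift_less[OF _ _ part] mono \<rho> by (metis gr0I)
    then show ?thesis
      using 2 by (simp add: tp2_unrolled xy src_def)
  next
    case 3
    then have "tp2 \<sigma> A (shift (\<rho> (seg y)) (org y)) (shift (\<rho> (seg x)) (org x)) =
        tp2 \<sigma> A (org y) (if 0 < seg y then f (org x) else org x)"
      using tp2_shift_less[OF _ _ part(2,1)] mono \<rho> by (metis gr0I)
    then show ?thesis
      using 3 by (intro tp2_eq_commute[of \<sigma> unrolled y x]) (simp add: tp2_unrolled xy src_def)
  qed
qed

text \<open>Any three elements of the unfolding lie in \<open>S 0\<close> and at most three further segments, which
  can be mapped to \<open>S 1\<close>, \<open>S 2\<close>, \<open>S 3\<close> in order.\<close>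

lemma transp_on_unrolled: "transp_on U (tr unrolled)"
proof (rule transp_onI)
  fix x y z
  assume xyz: "x \<in> U" "y \<in> U" "z \<in> U" and tr: "tr unrolled x y" "tr unrolled y z"
  define P where "P = {seg x, seg y, seg z}"
  \<comment> \<open>The rank among the nonzero segment numbers in \<open>P\<close>. Adding
    \<open>n\<close> to \<open>P\<close> keeps the rank of every nonzero \<open>n\<close> positive,
    even outside \<open>P\<close>.\<close>
  define \<rho> where "\<rho> n = (if n = 0 then 0 else card {m \<in> P \<union> {n}. 0 < m \<and> m \<le> n})" for n
  define \<theta> where "\<theta> u = shift (\<rho> (seg u)) (org u)" for u
  have fin: "finite P" and card: "card P \<le> 3"
    by (simp_all add: P_def card_insert_if)
  have \<rho>0: "\<rho> n = 0 \<longleftrightarrow> n = 0" for n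
    using fin by (auto simp: \<rho>_def)
  have \<rho>3: "\<rho> n \<le> 3" if "n \<in> P" for n
  proof -
    have "card {m \<in> P \<union> {n}. 0 < m \<and> m \<le> n} \<le> card P"
      using that fin by (intro card_mono) auto
    then show ?thesis
      using card by (simp add: \<rho>_def)
  qed
  have less: "\<rho> m < \<rho> n" if "m \<in> P" "n \<in> P" "m < n" for m n
  proof (cases "m = 0")
    case True
    then show ?thesis
      using \<rho>0 that by (metis gr0I)
  next
    case False
    have "{k \<in> P \<union> {m}. 0 < k \<and> k \<le> m} \<subseteq> {k \<in> P \<union> {n}. 0 < k \<and> k \<le> n}"
      using that by auto
    moreover have "n \<in> {k \<in> P \<union> {n}. 0 < k \<and> k \<le> n}" "n \<notin> {k \<in> P \<union> {m}. 0 < k \<and> k \<le> m}"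
      using that(3) by simp_all
    ultimately have "{k \<in> P \<union> {m}. 0 < k \<and> k \<le> m} \<subset> {k \<in> P \<union> {n}. 0 < k \<and> k \<le> n}"
      by blast
    then have "card {k \<in> P \<union> {m}. 0 < k \<and> k \<le> m} < card {k \<in> P \<union> {n}. 0 < k \<and> k \<le> n}"
      using fin by (intro psubset_card_mono) auto
    then show ?thesis
      using False that by (simp add: \<rho>_def)
  qed
  have iff: "\<rho> m < \<rho> n \<longleftrightarrow> m < n" if "m \<in> P" "n \<in> P" for m n
    using less[OF that] less[OF that(2,1)] by (cases m n rule: linorder_cases) auto
  have tr_iff: "tr unrolled u v \<longleftrightarrow> tr A (\<theta> u) (\<theta> v)" if "u \<in> {x, y, z}" "v \<in> {x, y, z}" for u v
  proof -
    have "u \<in> U" "v \<in> U" "seg u \<in> P" "seg v \<in> P"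
      using that xyz by (auto simp: P_def)
    then have "tp2 \<sigma> unrolled u v = tp2 \<sigma> A (\<theta> u) (\<theta> v)"
      unfolding \<theta>_def using \<rho>0 \<rho>3 iff by (intro tp2_unrolled_shift) auto
    then show ?thesis
      using T_in_\<sigma> by (simp add: tp2_eq_iff)
  qed
  have "\<theta> u \<in> univ A" if "u \<in> {x, y, z}" for u
  proof -
    have "u \<in> U" "seg u \<in> P"
      using that xyz by (auto simp: P_def)
    moreover have "org u \<in> part (\<rho> (seg u))"
      using org_in[OF \<open>u \<in> U\<close>] \<rho>0 by (simp add: part_def)
    ultimately have "\<theta> u \<in> S (\<rho> (seg u))" "\<rho> (seg u) \<in> {0, 1, 2, 3}"
      using shift_in \<rho>3[of "seg u"] by (auto simp: \<theta>_def)
    then show ?thesis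
      by (auto simp: univ_A)
  qed
  then show "tr unrolled x z"
    using transp_onD[OF trans_A, of "\<theta> x" "\<theta> y" "\<theta> z"] tr tr_iff by auto
qed

text \<open>A partner in \<open>S 0\<close> is found in segment 0, and one in \<open>S 2\<close> or
  \<open>S 3\<close> in the segment following that of \<open>x\<close>. \<open>S 3\<close> can share
  that place with \<open>S 2\<close> because both are related alike to \<open>S 0\<close> and to
  \<open>S 1\<close>.\<close>

lemma realize_in_unrolled:
  assumes "x \<in> U" "b \<in> univ A"
  obtains y where "y \<in> U" "tp2 \<sigma> unrolled x y = tp2 \<sigma> A (org x) b"
proof -
  have v02: "u \<in> S 0 \<Longrightarrow> v \<in> S 2 \<Longrightarrow> tp2 \<sigma> A u v = tp2 \<sigma> A u (g v)"
    and v01: "u \<in> S 0 \<Longrightarrow> v \<in> S 1 \<Longrightarrow> tp2 \<sigma> A u v = tp2 \<sigma> A u (f v)"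
    and v12: "u \<in> S 1 \<Longrightarrow> v \<in> S 2 \<Longrightarrow> tp2 \<sigma> A u v = tp2 \<sigma> A (f u) (g v)"
    and v13: "u \<in> S 1 \<Longrightarrow> v \<in> S 3 \<Longrightarrow> tp2 \<sigma> A u v = tp2 \<sigma> A (f u) v" for u v
    using via01 via02 via12 via13 by (auto simp: segs_via_def)
  have x: "org x \<in> part (seg x)"
    using org_in assms by blast
  consider "b \<in> S 0" | "b \<in> S 1" | c where "c \<in> S 1" "b = f c" | c where "c \<in> S 1" "b = g (f c)"
  proof -
    have "\<exists>c\<in>S 1. v = f c" if "v \<in> S 2" for v
      using f_image that by (auto simp del: One_nat_def)
    moreover have "\<exists>c\<in>S 2. v = g c" if "v \<in> S 3" for v
      using g_image that by auto
    ultimately show ?thesis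
      using that assms(2) univ_A by (metis UnE)
  qed
  then show ?thesis
  proof cases
    case 1
    then obtain y where "y \<in> U" "seg y = 0" "org y = b"
      using obtain_decode[of b 0] by (auto simp: part_def)
    then show ?thesis
      using that[of y] assms by (simp add: tp2_unrolled src_def)
  next
    case 2
    \<comment> \<open>The copy of \<open>S 1\<close> nearest to \<open>x\<close>: its own segment,
      or segment 1 if \<open>x\<close> lies in segment 0.\<close>
    then obtain y where "y \<in> U" "seg y = max 1 (seg x)" "org y = b"
      using obtain_decode[of b "max 1 (seg x)"] by (auto simp: part_def)
    moreover have "\<not> (0 < n \<and> n < max 1 n)" "\<not> max 1 n < n" for n :: nat
      by auto
    ultimately have "src x y = org x" "src y x = b"
      by (simp_all only: src_def simp_thms if_False)
    then show ?thesis
      using that[of y] \<open>y \<in> U\<close> assms by (simp add: tp2_unrolled)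
  next
    case 3
    then obtain y where y: "y \<in> U" "seg y = Suc (seg x)" "org y = c"
      using obtain_decode[of c "Suc (seg x)"] by (auto simp: part_def)
    then show ?thesis
      using that[of y] assms x v01[of "org x" c] 3
      by (cases "seg x = 0") (simp_all add: tp2_unrolled src_def part_def)
  next
    case 4
    then obtain y where y: "y \<in> U" "seg y = Suc (seg x)" "org y = c"
      using obtain_decode[of c "Suc (seg x)"] by (auto simp: part_def)
    have fc: "f c \<in> S 2" "g (f c) \<in> S 3"
      using 4 f_in[of c] g_in[of "f c"] by auto
    have "tp2 \<sigma> A (org x) b = tp2 \<sigma> A (org x) (if seg x = 0 then c else f c)"
    proof (cases "seg x = 0")
      case True
      then have "org x \<in> S 0"
        using x by (simp add: part_def)
      then show ?thesis
        using True 4 v01[of "org x" c] v02[of "org x" "f c"] fc by simp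
    next
      case False
      then have "org x \<in> S 1"
        using x by (simp add: part_def)
      then show ?thesis
        using False 4 v12[of "org x" "f c"] v13[of "org x" "g (f c)"] fc by simp
    qed
    then show ?thesis
      using that[of y] assms y by (simp add: tp2_unrolled src_def)
  qed
qed

text \<open>Each element originates in \<open>S 0\<close> or \<open>S 1\<close>, and
  \<open>realize_in_unrolled\<close> lifts the witnesses of its origin.\<close>

lemma model_unrolled:
  assumes nd: "normal_data \<psi>0 gs ds" and sym: "symbols (normal_sentence \<psi>0 gs ds) \<subseteq> \<sigma>"
    and ne: "S 0 \<noteq> {}"
    and all: "\<And>a b. a \<in> univ A \<Longrightarrow> b \<in> univ A \<Longrightarrow> holds A a b \<psi>0"
    and gam: "\<And>a i. a \<in> S 0 \<union> S 1 \<Longrightarrow> i < length gs \<Longrightarrow>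
      \<exists>b\<in>univ A. holds A a b (guard_dir (fst (gs ! i)) (snd (gs ! i)))"
    and del: "\<And>a i. a \<in> univ A \<Longrightarrow> i < length ds \<Longrightarrow> \<exists>b\<in>univ A. holds A a b (guard_both (ds ! i))"
  shows "model unrolled (normal_sentence \<psi>0 gs ds)"
proof -
  have U: "univ unrolled = U"
    by (simp add: weave_def)
  have org: "org x \<in> S 0 \<union> S 1" "org x \<in> univ A" if "x \<in> U" for x
    using org_in[OF that] univ_A by (auto simp: part_def split: if_splits)
  have witness: "\<exists>y\<in>U. holds unrolled x y \<phi>"
    if "x \<in> U" "\<exists>b\<in>univ A. holds A (org x) b \<phi>" "quantifier_free \<phi>" "symbols \<phi> \<subseteq> \<sigma>" for x \<phi>
    using that realize_in_unrolled[OF that(1)] holds_cong_tp2[OF _ that(3,4)] by metis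
  have "U \<noteq> {}"
    using ne obtain_decode[of _ 0] by (force simp: part_def)
  moreover have "holds unrolled x y \<psi>0" if "x \<in> U" "y \<in> U" for x y
    using holds_cong_tp2[OF tp2_unrolled[OF that] normal_data_components(1,2)[OF nd sym]]
      all[OF src_in src_in] that by blast
  moreover have "\<exists>y\<in>U. holds unrolled x y (guard_dir (fst (gs ! i)) (snd (gs ! i)))"
    if "x \<in> U" "i < length gs" for x i
    using that gam org normal_data_components(3,4)[OF nd sym] by (intro witness) blast+
  moreover have "\<exists>y\<in>U. holds unrolled x y (guard_both (ds ! i))" if "x \<in> U" "i < length ds" for x i
    using that del org normal_data_components(5,6)[OF nd sym] by (intro witness) blast+
  ultimately show ?thesis
    unfolding model_normal_sentence_iff U using transp_on_unrolled by blast
qed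

end

text \<open>Moves a structure given by countably many labels onto elements of a prescribed infinite
  type; \<open>d\<close> decodes an element into its label.\<close>

lemma infinite_embedding:
  assumes "infinite (UNIV :: 'a set)" "countable V"
  obtains d :: "'a \<Rightarrow> 'b" and U where "bij_betw d U V"
proof -
  obtain e :: "nat \<Rightarrow> 'a" where e: "inj e"
    using infinite_countable_subset[OF assms(1)] by blast
  have "inj_on (\<lambda>v. e (to_nat_on V v)) V"
    using inj_on_to_nat_on[OF assms(2)] e by (auto simp: inj_on_def)
  then have "bij_betw (\<lambda>v. e (to_nat_on V v)) V ((\<lambda>v. e (to_nat_on V v)) ` V)"
    by (simp add: inj_on_imp_bij_betw)
  then show ?thesis
    using that bij_betw_inv_into by blast
qed

lemma satisfiable_of_segments:
  fixes A :: "('p, 'a :: infinite) struct"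
  assumes nd: "normal_data \<psi>0 gs ds" and sym: "symbols (normal_sentence \<psi>0 gs ds) \<subseteq> \<sigma>"
    and "T \<in> \<sigma>" "finite (univ A)"
    and part: "partition_on (univ A) {S 0, S 1, S 2, S 3}" and sim: "similar_segments \<sigma> A S"
    and trans: "transp_on (univ A) (tr A)"
    and all: "\<And>a b. a \<in> univ A \<Longrightarrow> b \<in> univ A \<Longrightarrow> holds A a b \<psi>0"
    and gam: "\<And>a i. a \<in> S 0 \<union> S 1 \<Longrightarrow> i < length gs \<Longrightarrow>
      \<exists>b\<in>univ A. holds A a b (guard_dir (fst (gs ! i)) (snd (gs ! i)))"
    and del: "\<And>a i. a \<in> univ A \<Longrightarrow> i < length ds \<Longrightarrow> \<exists>b\<in>univ A. holds A a b (guard_both (ds ! i))"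
  shows "satisfiable TYPE('a) (normal_sentence \<psi>0 gs ds)"
proof -
  obtain f g where
    "segs_via \<sigma> A id f (S 0) (S 1) (S 0) (S 2)" "segs_via \<sigma> A id g (S 0) (S 2) (S 0) (S 3)"
    "segs_via \<sigma> A f g (S 1) (S 2) (S 2) (S 3)" "segs_via \<sigma> A f id (S 1) (S 3) (S 2) (S 3)"
    using sim unfolding similar_segments_def by blast
  moreover have U: "univ A = S 0 \<union> S 1 \<union> S 2 \<union> S 3" and ne: "S 0 \<noteq> {}"
    using part by (auto simp: partition_on_def)
  moreover have "countable ({0} \<times> S 0 \<union> {1::nat..} \<times> S 1)"
  proof -
    have "finite (S 0)" "finite (S 1)"
      using assms(4) U by auto
    then show ?thesis
      by (intro countable_Un countable_SIGMA) (simp_all add: countable_finite)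
  qed
  then obtain d :: "'a \<Rightarrow> nat \<times> 'a" and V where "bij_betw d V ({0} \<times> S 0 \<union> {1..} \<times> S 1)"
    using infinite_embedding[OF infinite_UNIV] by blast
  then have "bij_betw (\<lambda>u. ((fst \<circ> d) u, (snd \<circ> d) u)) V ({0} \<times> S 0 \<union> {1..} \<times> S 1)"
    by simp
  ultimately interpret unfolding_segments A \<sigma> S f g V "fst \<circ> d" "snd \<circ> d"
    using trans \<open>T \<in> \<sigma>\<close> by unfold_locales
  show ?thesis
    unfolding satisfiable_def using model_unrolled[OF nd sym ne all gam del] by blast
qed

section \<open>Splices outnumber clique sizes\<close>

text \<open>A disjoint union of cliques of sizes 1 to \<open>h (card \<sigma>)\<close> obeys the
  clique bound, and its cliques are pairwise non-isomorphic, hence have that many distinct splices.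
  This later absorbs a second factor \<open>h\<close> in the count of witnesses of royal
  elements.\<close>

lemma clique_bound_le_splice_bound:
  fixes \<sigma> :: "'p symb set"
  assumes "splice_bound TYPE('p) TYPE('a :: infinite) h s" "signature \<sigma>"
  shows "h (card \<sigma>) \<le> s (card \<sigma>)"
proof (cases "h (card \<sigma>) = 0")
  case False
  define n where "n = h (card \<sigma>)"
  \<comment> \<open>Block \<open>i\<close> has the \<open>i + 1\<close> labels
    \<open>(i, 0), ..., (i, i)\<close>, so the sizes run from 1 to \<open>n\<close>.\<close>
  define V where "V = (SIGMA i:{..<n}. {..i})"
  have "finite V"
    by (simp add: V_def)
  then obtain d :: "'a \<Rightarrow> nat \<times> nat" and U where d: "bij_betw d U V"
    using infinite_embedding[OF infinite_UNIV] countable_finite by blast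
  define A :: "('p, 'a) struct" where
    "A = \<lparr>univ = U, tr = \<lambda>a b. fst (d a) = fst (d b), rel0 = \<lambda>_. False, rel1 = \<lambda>_ _. False,
       rel2 = \<lambda>_ _ _. False\<rparr>"
  define block where "block i = {u \<in> U. fst (d u) = i}" for i
  have dV: "u \<in> U \<Longrightarrow> d u \<in> V" for u
    using d by (auto simp: bij_betw_def)
  have "d ` block i = {i} \<times> {..i}" if "i < n" for i
  proof -
    have "d ` block i = {v \<in> d ` U. fst v = i}"
      by (auto simp: block_def)
    also have "d ` U = V"
      using d by (simp add: bij_betw_def)
    finally show ?thesis
      using that by (auto simp: V_def)
  qed
  moreover have "inj_on d (block i)" for i
    using d by (auto simp: bij_betw_def block_def intro: inj_on_subset)
  ultimately have card_block: "card (block i) = Suc i" if "i < n" for i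
    using that card_image[of d "block i"] by simp
  have fin: "finite (block i)" if "i < n" for i
    using card_block[OF that] by (intro card_ge_0_finite) simp
  have trans: "transp_on (univ A) (tr A)"
    by (auto simp: A_def transp_on_def)
  have cl: "cl A u = block (fst (d u))" if "u \<in> U" for u
    using that by (auto simp: A_def cl_def block_def)
  have fst_less: "fst (d u) < n" if "u \<in> U" for u
    using dV[OF that] by (auto simp: V_def)
  have ne: "block i \<noteq> {}" if "i < n" for i
    using card_block[OF that] by auto
  have clique_block: "clique A (block i)" if i: "i < n" for i
  proof -
    obtain u where "u \<in> U" "fst (d u) = i"
      using ne[OF i] by (auto simp: block_def)
    then show ?thesis
      using clique_cl[OF trans, of u] cl by (simp add: A_def)
  qed
  have "cliques_at_most n A"
    unfolding cliques_at_most_def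
  proof (intro allI impI)
    fix B
    assume B: "clique A B"
    show "finite B \<and> card B \<le> n"
    proof (cases "B = {}")
      case False
      then obtain u where u: "u \<in> B"
        by blast
      then have "u \<in> U"
        using B by (auto simp: clique_def A_def)
      then have "B = block (fst (d u))" "fst (d u) < n"
        using clique_eq_cl[OF trans B u] cl fst_less by auto
      then show ?thesis
        using fin card_block by simp
    qed simp
  qed
  moreover have "univ A \<noteq> {}"
    using ne[of 0] False by (auto simp: A_def block_def n_def)
  ultimately have bound: "finite (splice \<sigma> A ` {B. clique A B})"
    "card (splice \<sigma> A ` {B. clique A B}) \<le> s (card \<sigma>)"
    using assms trans unfolding splice_bound_def n_def by blast+
  have "inj_on (\<lambda>i. splice \<sigma> A (block i)) {..<n}"
  proof (rule inj_onI)
    fix i j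
    assume ij: "i \<in> {..<n}" "j \<in> {..<n}" and "splice \<sigma> A (block i) = splice \<sigma> A (block j)"
    then have "iso_type \<sigma> (restrict_struct A (block i)) = iso_type \<sigma> (restrict_struct A (block j))"
      by (simp add: splice_def)
    \<comment> \<open>An isomorphism type contains the structure itself, so equal types yield an
      actual isomorphism.\<close>
    moreover have "restrict_struct A (block j) \<in> iso_type \<sigma> (restrict_struct A (block j))"
      unfolding iso_type_def using iso_restrictI[of id] by fastforce
    ultimately obtain f where "iso \<sigma> f (restrict_struct A (block i)) (restrict_struct A (block j))"
      by (auto simp: iso_type_def)
    then have "card (block i) = card (block j)"
      by (auto simp: iso_def restrict_struct_def dest: bij_betw_same_card)
    then show "i = j"
      using card_block ij by simp
  qed
  moreover have "(\<lambda>i. splice \<sigma> A (block i)) ` {..<n} \<subseteq> splice \<sigma> A ` {B. clique A B}"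
    using clique_block by auto
  ultimately have "n \<le> card (splice \<sigma> A ` {B. clique A B})"
    using bound(1) card_inj_on_le by fastforce
  then show ?thesis
    using bound(2) by (simp add: n_def)
qed simp

section \<open>Profiles of cliques\<close>

text \<open>A triple holds the sets of 1-types in, below and above a clique. The first two
  inclusions supply pairs of \<open>A\<close> with the required 1-types and order; the last two make
  the relation transitive.\<close>

fun below :: "'b set \<times> 'b set \<times> 'b set \<Rightarrow> 'b set \<times> 'b set \<times> 'b set \<Rightarrow> bool" where
  "below (P, D, E) (P', D', E') \<longleftrightarrow> P' \<subseteq> E \<and> P \<subseteq> D' \<and> E' \<subseteq> E \<and> D \<subseteq> D'"

lemma below_trans: "below p q \<Longrightarrow> below q r \<Longrightarrow> below p r"
  by (cases p; cases q; cases r) auto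

locale typed_order =
  fixes A :: "('p, 'a) struct" and \<sigma> :: "'p symb set"
  assumes trans_A: "transp_on (univ A) (tr A)"
begin

definition lt :: "'a \<Rightarrow> 'a \<Rightarrow> bool" where
  "lt a b \<longleftrightarrow> tr A a b \<and> \<not> tr A b a"

text \<open>The splice of the clique of \<open>a\<close> with the isomorphism type weakened to the set of 1-types.\<close>

definition profile :: "'a \<Rightarrow> 'p fo2 set set \<times> 'p fo2 set set \<times> 'p fo2 set set" where
  "profile a = (tp1 \<sigma> A ` cl A a, tp1 \<sigma> A ` {b \<in> univ A. lt b a}, tp1 \<sigma> A ` {b \<in> univ A. lt a b})"

definition prec :: "'a \<Rightarrow> 'a \<Rightarrow> bool" where
  "prec a b \<longleftrightarrow> below (profile a) (profile b)"

text \<open>The two ways of relating distinct copies of one clique are excluded: ordering them would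
  need \<open>prec a a\<close>, and leaving them incomparable would need a second clique with the
  same profile.\<close>

definition royal :: "'a \<Rightarrow> bool" where
  "royal a \<longleftrightarrow> \<not> prec a a \<and> (\<forall>b\<in>univ A. profile b = profile a \<longrightarrow> b \<in> cl A a)"

lemma trans: "a \<in> univ A \<Longrightarrow> b \<in> univ A \<Longrightarrow> c \<in> univ A \<Longrightarrow> tr A a b \<Longrightarrow> tr A b c \<Longrightarrow> tr A a c"
  using transp_onD[OF trans_A] by blast

lemma lt_trans: "a \<in> univ A \<Longrightarrow> b \<in> univ A \<Longrightarrow> c \<in> univ A \<Longrightarrow> lt a b \<Longrightarrow> lt b c \<Longrightarrow> lt a c"
  unfolding lt_def using trans by blast

lemma cl_subset: "cl A a \<subseteq> univ A"
  by (auto simp: cl_def)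

lemma lt_cl:
  assumes "a \<in> univ A" "c \<in> univ A" "b \<in> cl A a"
  shows "lt b c \<longleftrightarrow> lt a c" "lt c b \<longleftrightarrow> lt c a"
proof -
  have b: "b \<in> univ A" "b = a \<or> tr A a b \<and> tr A b a"
    using assms by (auto simp: cl_def)
  show "lt b c \<longleftrightarrow> lt a c" "lt c b \<longleftrightarrow> lt c a"
    using b(2) trans[OF assms(1) b(1) assms(2)] trans[OF b(1) assms(1,2)]
      trans[OF assms(2) b(1) assms(1)] trans[OF assms(2,1) b(1)]
    unfolding lt_def by blast+
qed

lemma profile_cl: "a \<in> univ A \<Longrightarrow> b \<in> cl A a \<Longrightarrow> profile b = profile a"
proof -
  assume ab: "a \<in> univ A" "b \<in> cl A a"
  then have "{c \<in> univ A. lt c b} = {c \<in> univ A. lt c a}" "{c \<in> univ A. lt b c} = {c \<in> univ A. lt a c}"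
    using lt_cl[OF ab(1) _ ab(2)] by blast+
  then show ?thesis
    unfolding profile_def using cl_eq[OF trans_A ab] by simp
qed

lemma royal_cl: "a \<in> univ A \<Longrightarrow> b \<in> cl A a \<Longrightarrow> royal b \<longleftrightarrow> royal a"
  unfolding royal_def prec_def using profile_cl[of a b] cl_eq[OF trans_A, of a b] by simp

lemma prec_trans: "prec a b \<Longrightarrow> prec b c \<Longrightarrow> prec a c"
  unfolding prec_def by (rule below_trans)

text \<open>By transitivity of \<open>T\<close> the clique of \<open>a\<close> lies entirely below
  that of \<open>b\<close>, and whatever is above \<open>b\<close> or below \<open>a\<close> is
  passed on; these are the four inclusions of \<open>below\<close>.\<close>

lemma lt_imp_prec:
  assumes "a \<in> univ A" "b \<in> univ A" "lt a b"
  shows "prec a b"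
proof -
  have "lt a c" if "c \<in> cl A b" for c
    using lt_cl(2)[OF assms(2,1) that] assms(3) by simp
  moreover have "lt c b" if "c \<in> cl A a" for c
    using lt_cl(1)[OF assms(1,2) that] assms(3) by simp
  moreover have "lt a c" if "c \<in> univ A" "lt b c" for c
    using lt_trans[OF assms(1,2) that(1)] assms(3) that(2) by simp
  moreover have "lt c b" if "c \<in> univ A" "lt c a" for c
    using lt_trans[OF that(1) assms(1,2)] assms(3) that(2) by simp
  ultimately show ?thesis
    unfolding prec_def profile_def below.simps using cl_subset
    by (intro conjI image_mono) blast+
qed

text \<open>Supplies the pair of \<open>A\<close> from which cliques ordered by \<open>prec\<close>
  borrow their 2-types.\<close>

lemma prec_realizes:
  assumes "b \<in> univ A" "prec a b"
  obtains c where "c \<in> univ A" "lt a c" "tp1 \<sigma> A c = tp1 \<sigma> A b"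
proof -
  have "tp1 \<sigma> A ` cl A b \<subseteq> tp1 \<sigma> A ` {c \<in> univ A. lt a c}"
    using assms(2) by (simp add: prec_def profile_def)
  then have "tp1 \<sigma> A b \<in> tp1 \<sigma> A ` {c \<in> univ A. lt a c}"
    using self_in_cl[OF assms(1)] by blast
  then show ?thesis
    using that by force
qed

lemma profile_realizes:
  assumes "a \<in> univ A" "profile b = profile a"
  obtains c where "c \<in> cl A b" "tp1 \<sigma> A c = tp1 \<sigma> A a"
proof -
  have "tp1 \<sigma> A a \<in> tp1 \<sigma> A ` cl A b"
    using self_in_cl[OF assms(1)] assms(2) by (auto simp: profile_def)
  then show ?thesis
    using that by force
qed

text \<open>Isomorphic cliques realize the same 1-types, and the other two components of a splice
  are those of the profile.\<close>

lemma profile_eq_of_splice_eq: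
  assumes a: "a \<in> univ A" and b: "b \<in> univ A" and T: "T \<in> \<sigma>"
    and eq: "splice \<sigma> A (cl A a) = splice \<sigma> A (cl A b)"
  shows "profile a = profile b"
proof -
  have below: "{x \<in> univ A. \<forall>y\<in>cl A c. tr A x y \<and> \<not> tr A y x} = {x \<in> univ A. lt x c}"
    and above: "{x \<in> univ A. \<forall>y\<in>cl A c. tr A y x \<and> \<not> tr A x y} = {x \<in> univ A. lt c x}"
    if "c \<in> univ A" for c
    using lt_cl[OF that] self_in_cl[OF that] unfolding lt_def by blast+
  have "iso_type \<sigma> (restrict_struct A (cl A a)) = iso_type \<sigma> (restrict_struct A (cl A b))"
    using eq by (simp add: splice_def)
  moreover have "restrict_struct A (cl A b) \<in> iso_type \<sigma> (restrict_struct A (cl A b))"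
    unfolding iso_type_def using iso_restrictI[of id] by fastforce
  ultimately obtain f where f: "iso \<sigma> f (restrict_struct A (cl A a)) (restrict_struct A (cl A b))"
    by (auto simp: iso_type_def)
  have "tp1 \<sigma> A (f x) = tp1 \<sigma> A x" if "x \<in> cl A a" for x
    using iso_tp2[OF f that that] by (simp add: tp2_eq_iff)
  then have "tp1 \<sigma> A ` f ` cl A a = tp1 \<sigma> A ` cl A a"
    by (force simp: image_def)
  moreover have "f ` cl A a = cl A b"
    using f by (simp add: iso_def restrict_struct_def bij_betw_def)
  ultimately show ?thesis
    using eq below above a b by (simp add: splice_def profile_def)
qed

lemma card_profiles_le:
  assumes "T \<in> \<sigma>" "finite (splice \<sigma> A ` {B. clique A B})"
  shows "finite (profile ` univ A)"
    and "card (profile ` univ A) \<le> card (splice \<sigma> A ` {B. clique A B})"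
proof -
  \<comment> \<open>Profiles are a function of splices, so they form an image of the set of
    splices.\<close>
  define F where "F t = profile (SOME a. a \<in> univ A \<and> splice \<sigma> A (cl A a) = t)" for t
  have "F (splice \<sigma> A (cl A a)) = profile a" if a: "a \<in> univ A" for a
  proof -
    let ?P = "\<lambda>b. b \<in> univ A \<and> splice \<sigma> A (cl A b) = splice \<sigma> A (cl A a)"
    have "?P (SOME b. ?P b)"
      by (rule someI[of ?P a]) (simp add: a)
    then show ?thesis
      unfolding F_def using profile_eq_of_splice_eq a assms(1) by blast
  qed
  moreover have "splice \<sigma> A (cl A a) \<in> splice \<sigma> A ` {B. clique A B}" if "a \<in> univ A" for a
    using clique_cl[OF trans_A that] by blast
  ultimately have "profile ` univ A \<subseteq> F ` splice \<sigma> A ` {B. clique A B}"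
    by (metis (no_types, lifting) image_eqI image_subsetI)
  then show "finite (profile ` univ A)"
    and "card (profile ` univ A) \<le> card (splice \<sigma> A ` {B. clique A B})"
    using assms(2) finite_subset surj_card_le by blast+
qed

end

section \<open>Reduction to four finite segments\<close>

lemma finite_card_UN:
  assumes "finite I" "\<And>i. i \<in> I \<Longrightarrow> finite (B i)" "\<And>i. i \<in> I \<Longrightarrow> card (B i) \<le> n"
  shows "finite (\<Union>i\<in>I. B i)" "card (\<Union>i\<in>I. B i) \<le> card I * n"
proof -
  have "card (\<Union>i\<in>I. B i) \<le> (\<Sum>i\<in>I. card (B i))"
    using assms(1) by (rule card_UN_le)
  also have "\<dots> \<le> card I * n"
    using assms(3) sum_bounded_above[of I "\<lambda>i. card (B i)" n] by simp
  finally show "card (\<Union>i\<in>I. B i) \<le> card I * n" .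
qed (use assms in simp)

text \<open>\<open>w i a\<close> is a chosen witness of \<open>a\<close> for the \<open>i\<close>-th
  formula and \<open>fwd i\<close> tells its direction. A model without a non-royal
  \<open>c0\<close> is treated separately, since it is already small.\<close>

locale reduction = typed_order A \<sigma> for A :: "('p, 'a) struct" and \<sigma> :: "'p symb set" +
  fixes w :: "nat \<Rightarrow> 'a \<Rightarrow> 'a" and m :: nat and fwd :: "nat \<Rightarrow> bool" and c0 :: 'a and k :: nat
  assumes T_in_\<sigma>: "T \<in> \<sigma>"
    and w_in: "i < m \<Longrightarrow> a \<in> univ A \<Longrightarrow> w i a \<in> univ A"
    and w_lt: "i < m \<Longrightarrow> a \<in> univ A \<Longrightarrow> if fwd i then lt a (w i a) else lt (w i a) a"
    and c0: "c0 \<in> univ A" "\<not> royal c0"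
    and fin_cl: "a \<in> univ A \<Longrightarrow> finite (cl A a)"
    and card_cl: "a \<in> univ A \<Longrightarrow> card (cl A a) \<le> k"
    and fin_profiles: "finite (profile ` univ A)"
begin

definition rep :: "'p fo2 set set \<times> 'p fo2 set set \<times> 'p fo2 set set \<Rightarrow> 'a" where
  "rep t = (SOME a. a \<in> univ A \<and> profile a = t)"

text \<open>Royal elements keep their relations in \<open>A\<close>, so the cliques of their actual
  witnesses are included. The clique of \<open>c0\<close> keeps the set nonempty.\<close>

definition base :: "'a set" where
  "base = {a \<in> univ A. royal a} \<union> (\<Union>a\<in>{a \<in> univ A. royal a}. \<Union>i<m. cl A (w i a)) \<union> cl A c0"

definition common :: "'a set" where
  "common = (\<Union>t\<in>profile ` {a \<in> univ A. \<not> royal a}. cl A (rep t))"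

text \<open>The stand-in for \<open>a\<close> in the representative clique: it has the 1-type of
  \<open>a\<close>, and its clique has the same place in \<open>prec\<close>.\<close>

definition twin :: "'a \<Rightarrow> 'a" where
  "twin a = (SOME b. b \<in> cl A (rep (profile a)) \<and> tp1 \<sigma> A b = tp1 \<sigma> A a)"

lemma rep_profile: "a \<in> univ A \<Longrightarrow> rep (profile a) \<in> univ A \<and> profile (rep (profile a)) = profile a"
  unfolding rep_def by (rule someI) simp

lemma royal_profile:
  assumes "a \<in> univ A" "b \<in> univ A" "profile a = profile b"
  shows "royal a \<longleftrightarrow> royal b"
proof -
  have "royal d" if "royal c" "c \<in> univ A" "d \<in> univ A" "profile c = profile d" for c d
    using that royal_cl[of c d] unfolding royal_def by metis
  then show ?thesis
    using assms by metis
qed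

lemma twin:
  assumes "a \<in> univ A"
  shows "twin a \<in> cl A (rep (profile a))" "tp1 \<sigma> A (twin a) = tp1 \<sigma> A a"
proof -
  obtain b where "b \<in> cl A (rep (profile a))" "tp1 \<sigma> A b = tp1 \<sigma> A a"
    using profile_realizes[of a "rep (profile a)"] assms rep_profile by blast
  then have "twin a \<in> cl A (rep (profile a)) \<and> tp1 \<sigma> A (twin a) = tp1 \<sigma> A a"
    unfolding twin_def using someI_ex[of "\<lambda>b. b \<in> cl A (rep (profile a)) \<and> tp1 \<sigma> A b = tp1 \<sigma> A a"] by blast
  then show "twin a \<in> cl A (rep (profile a))" "tp1 \<sigma> A (twin a) = tp1 \<sigma> A a"
    by simp_all
qed

lemma profile_twin: "a \<in> univ A \<Longrightarrow> profile (twin a) = profile a"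
  using profile_cl[OF _ twin(1)] rep_profile by simp

lemma twin_in_common: "a \<in> univ A \<Longrightarrow> \<not> royal a \<Longrightarrow> twin a \<in> common"
  using twin(1) by (auto simp: common_def)

lemma base_subset: "base \<subseteq> univ A"
  unfolding base_def using cl_subset by blast

lemma common_subset: "common \<subseteq> univ A"
  unfolding common_def using cl_subset by blast

lemma common_not_royal: "a \<in> common \<Longrightarrow> \<not> royal a"
proof -
  assume "a \<in> common"
  then obtain b where b: "b \<in> univ A" "\<not> royal b" "a \<in> cl A (rep (profile b))"
    by (auto simp: common_def)
  then show ?thesis
    using rep_profile[OF b(1)] royal_cl[OF _ b(3)] royal_profile[OF b(1), of "rep (profile b)"] by simp
qed

lemma base_cl: "a \<in> base \<Longrightarrow> cl A a \<subseteq> base"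
proof -
  assume a: "a \<in> base"
  then consider "royal a" "a \<in> univ A" | b i where "royal b" "b \<in> univ A" "i < m" "a \<in> cl A (w i b)" | "a \<in> cl A c0"
    by (auto simp: base_def)
  then show ?thesis
  proof cases
    case 1
    then have "royal b \<and> b \<in> univ A" if "b \<in> cl A a" for b
      using that royal_cl cl_subset by blast
    then show ?thesis
      unfolding base_def by blast
  next
    case 2
    then have "cl A a = cl A (w i b)"
      using cl_eq[OF trans_A] w_in by blast
    then show ?thesis
      unfolding base_def using 2 by blast
  next
    case 3
    then show ?thesis
      unfolding base_def using cl_eq[OF trans_A] c0 by blast
  qed
qed

lemma common_cl: "a \<in> common \<Longrightarrow> cl A a \<subseteq> common"
proof -
  assume "a \<in> common"
  then obtain b where b: "b \<in> univ A" "\<not> royal b" "a \<in> cl A (rep (profile b))"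
    by (auto simp: common_def)
  then have "cl A a = cl A (rep (profile b))"
    using cl_eq[OF trans_A] rep_profile by blast
  then show ?thesis
    unfolding common_def using b by blast
qed

lemma common_card: "finite common" "card common \<le> card (profile ` univ A) * k"
proof -
  let ?I = "profile ` {a \<in> univ A. \<not> royal a}"
  have sub: "?I \<subseteq> profile ` univ A"
    by blast
  have "finite (cl A (rep t)) \<and> card (cl A (rep t)) \<le> k" if "t \<in> ?I" for t
    using that rep_profile fin_cl card_cl by auto
  then have "finite common" "card common \<le> card ?I * k"
    unfolding common_def using finite_card_UN[of ?I "\<lambda>t. cl A (rep t)" k] finite_subset[OF sub fin_profiles]
    by blast+
  moreover have "card ?I * k \<le> card (profile ` univ A) * k"
    using card_mono[OF fin_profiles sub] by simp
  ultimately show "finite common" "card common \<le> card (profile ` univ A) * k"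
    by linarith+
qed

text \<open>A royal profile belongs to a single clique, and the profile of \<open>c0\<close> is not
  royal. That leaves \<open>k\<close> to spare, which pays for the clique of \<open>c0\<close> in
  \<open>base\<close>.\<close>

lemma royal_card:
  "finite {a \<in> univ A. royal a}" "card {a \<in> univ A. royal a} + k \<le> card (profile ` univ A) * k"
proof -
  let ?R = "{a \<in> univ A. royal a}" and ?I = "profile ` {a \<in> univ A. royal a}"
  have sub: "?I \<subseteq> profile ` univ A"
    by blast
  have fin: "finite ?I"
    using finite_subset[OF sub fin_profiles] .
  have "?R = (\<Union>t\<in>?I. cl A (rep t))"
  proof (intro equalityI subsetI)
    fix a
    assume "a \<in> ?R"
    then have a: "a \<in> univ A" "royal a"
      by auto
    then have "rep (profile a) \<in> cl A a"
      using rep_profile[OF a(1)] by (auto simp: royal_def)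
    then have "a \<in> cl A (rep (profile a))"
      using cl_eq[OF trans_A a(1)] self_in_cl[OF a(1)] by blast
    then show "a \<in> (\<Union>t\<in>?I. cl A (rep t))"
      using a by blast
  next
    fix a
    assume "a \<in> (\<Union>t\<in>?I. cl A (rep t))"
    then obtain b where b: "b \<in> univ A" "royal b" "a \<in> cl A (rep (profile b))"
      by blast
    then have "royal (rep (profile b))"
      using rep_profile[OF b(1)] royal_profile[of b "rep (profile b)"] by simp
    then show "a \<in> ?R"
      using royal_cl[OF _ b(3)] b cl_subset rep_profile[OF b(1)] by blast
  qed
  moreover have "finite (cl A (rep t)) \<and> card (cl A (rep t)) \<le> k" if "t \<in> ?I" for t
    using that rep_profile fin_cl card_cl by auto
  ultimately have R: "finite ?R" "card ?R \<le> card ?I * k"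
    using finite_card_UN[of ?I "\<lambda>t. cl A (rep t)" k] fin by simp_all
  have "profile c0 \<notin> ?I"
    using royal_profile[of c0] c0 by auto
  then have "?I \<subset> profile ` univ A"
    using c0 by blast
  then have "card ?I + 1 \<le> card (profile ` univ A)"
    using psubset_card_mono[OF fin_profiles] by (simp add: Suc_leI)
  then have "(card ?I + 1) * k \<le> card (profile ` univ A) * k"
    by (rule mult_le_mono1)
  then show "finite ?R" "card ?R + k \<le> card (profile ` univ A) * k"
    using R by (simp_all add: algebra_simps)
qed

lemma base_card: "finite base" "card base \<le> card (profile ` univ A) * k * (1 + m * k)"
proof -
  let ?R = "{a \<in> univ A. royal a}"
  define W where "W = (\<Union>(a, i)\<in>?R \<times> {..<m}. cl A (w i a))"
  have base: "base = ?R \<union> W \<union> cl A c0"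
    by (auto simp: base_def W_def)
  have W: "finite W" "card W \<le> card ?R * m * k"
    using finite_card_UN[of "?R \<times> {..<m}" "\<lambda>(a, i). cl A (w i a)" k] royal_card(1) w_in fin_cl card_cl
    by (auto simp: W_def card_cartesian_product)
  then show "finite base"
    using base royal_card(1) fin_cl[OF c0(1)] by simp
  have "card base \<le> card ?R + card W + card (cl A c0)"
    unfolding base using card_Un_le[of "?R \<union> W" "cl A c0"] card_Un_le[of ?R W] by linarith
  also have "\<dots> \<le> (card ?R + k) + card ?R * (m * k)"
    using W card_cl[OF c0(1)] by (simp add: algebra_simps)
  also have "\<dots> \<le> (card ?R + k) * (1 + m * k)"
    by (simp add: algebra_simps)
  also have "\<dots> \<le> card (profile ` univ A) * k * (1 + m * k)"
    using royal_card(2) by (rule mult_le_mono1)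
  finally show "card base \<le> card (profile ` univ A) * k * (1 + m * k)" .
qed

text \<open>Labels are segment, copy and element. Copies \<open>0\<close> to \<open>m - 1\<close>
  serve the \<open>m\<close> formulas; copy \<open>m\<close> keeps segments 1 to 3 nonempty even
  when \<open>m = 0\<close>.\<close>

definition nodes :: "(nat \<times> nat \<times> 'a) set" where
  "nodes = {0} \<times> {0} \<times> base \<union> {1..3} \<times> {..m} \<times> common"

lemma nodes_card:
  "finite nodes" "card nodes \<le> card base + 3 * (m + 1) * card common"
proof -
  have "card nodes \<le> card ({0::nat} \<times> {0::nat} \<times> base) + card ({1..3::nat} \<times> {..m} \<times> common)"
    unfolding nodes_def by (rule card_Un_le)
  then show "card nodes \<le> card base + 3 * (m + 1) * card common"
    by (simp add: card_cartesian_product algebra_simps)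
  show "finite nodes"
    by (simp add: nodes_def base_card common_card)
qed

end

text \<open>An element \<open>x\<close> of the new structure is copy \<open>cop x\<close> of the element \<open>org x\<close> of \<open>A\<close> in the
  segment \<open>seg x\<close>.\<close>

locale segmented_copy = reduction A \<sigma> w m fwd c0 k
  for A :: "('p, 'a) struct" and \<sigma> w m fwd c0 k +
  fixes U :: "'u set" and seg cop :: "'u \<Rightarrow> nat" and org :: "'u \<Rightarrow> 'a"
  assumes decode: "bij_betw (\<lambda>u. (seg u, cop u, org u)) U nodes"
begin

definition same :: "'u \<Rightarrow> 'u \<Rightarrow> bool" where
  "same x y \<longleftrightarrow> seg x = seg y \<and> cop x = cop y \<and> cl A (org x) = cl A (org y)"

text \<open>Cliques whose profiles allow either order are ordered by position: copy \<open>i < m\<close> in a later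
  segment lies above, respectively below, all earlier segments, as required of the witnesses for the
  \<open>i\<close>-th formula. Ties are broken arbitrarily.\<close>

definition pos :: "'u \<Rightarrow> int" where
  "pos x = (if cop x < m \<and> \<not> fwd (cop x) then - int (seg x) else int (seg x))"

definition lin :: "'u \<Rightarrow> 'u \<Rightarrow> bool" where
  "lin x y \<longleftrightarrow> pos x < pos y \<or> pos x = pos y \<and> (cop x < cop y \<or> cop x = cop y \<and>
     to_nat_on (cl A ` (base \<union> common)) (cl A (org x)) < to_nat_on (cl A ` (base \<union> common)) (cl A (org y)))"

definition ord :: "'u \<Rightarrow> 'u \<Rightarrow> bool" where
  "ord x y \<longleftrightarrow> prec (org x) (org y) \<and> (prec (org y) (org x) \<longrightarrow> lin x y)"

text \<open>\<open>y\<close> is the designated witness of \<open>x\<close> for the formula numbered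
  \<open>cop y\<close>: it stands for the actual witness in \<open>A\<close>, whose 2-type with
  \<open>org x\<close> the pair must then receive. Witnesses involving royal elements are found in
  segment 0 instead.\<close>

definition demand :: "'u \<Rightarrow> 'u \<Rightarrow> bool" where
  "demand x y \<longleftrightarrow> \<not> royal (org x) \<and> \<not> royal (org y) \<and> seg x < seg y \<and> cop y < m \<and>
     \<not> royal (w (cop y) (org x)) \<and> org y = twin (w (cop y) (org x))"

text \<open>\<open>good x y a b\<close>: the pair \<open>x, y\<close> may be given the 2-type of \<open>a, b\<close>. The last three clauses
  secure the witnesses: royal elements keep their relations in \<open>A\<close>, and demands go from earlier to
  later segments only, so that they do not conflict.\<close>

definition good :: "'u \<Rightarrow> 'u \<Rightarrow> 'a \<Rightarrow> 'a \<Rightarrow> bool" where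
  "good x y a b \<longleftrightarrow> a \<in> univ A \<and> b \<in> univ A \<and> a \<noteq> b \<and>
     tp1 \<sigma> A a = tp1 \<sigma> A (org x) \<and> tp1 \<sigma> A b = tp1 \<sigma> A (org y) \<and>
     (tr A a b \<longleftrightarrow> ord x y) \<and> (tr A b a \<longleftrightarrow> ord y x) \<and>
     ((royal (org x) \<or> royal (org y)) \<and> (lt (org x) (org y) \<or> lt (org y) (org x)) \<longrightarrow>
        a = org x \<and> b = org y) \<and>
     (demand x y \<longrightarrow> a = org x \<and> b = w (cop y) (org x)) \<and>
     (demand y x \<longrightarrow> b = org y \<and> a = w (cop x) (org y))"

text \<open>The pair chosen for \<open>x, y\<close> is that for \<open>y, x\<close> reversed, and it depends on the segments of
  \<open>x\<close> and \<open>y\<close> only through their order. Choosing a function on keys achieves both.\<close>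

definition key :: "'u \<Rightarrow> 'u \<Rightarrow> bool \<times> nat \<times> 'a" where
  "key x y = (seg y < seg x, cop x, org x)"

definition src :: "'u \<Rightarrow> 'u \<Rightarrow> 'a" where
  "src x y = (if same x y then org x else (SOME r. good x y (r (key x y)) (r (key y x))) (key x y))"

section \<open>Labels and the strict order of the copied cliques\<close>

lemma decode_in: "x \<in> U \<Longrightarrow> (seg x, cop x, org x) \<in> nodes"
  using decode by (auto simp: bij_betw_def)

lemma org_in: "x \<in> U \<Longrightarrow> org x \<in> univ A"
  using decode_in base_subset common_subset by (fastforce simp: nodes_def)

lemma org_base_common: "x \<in> U \<Longrightarrow> org x \<in> base \<union> common"
  using decode_in by (fastforce simp: nodes_def)

lemma org_common: "x \<in> U \<Longrightarrow> seg x \<noteq> 0 \<Longrightarrow> org x \<in> common"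
  using decode_in by (fastforce simp: nodes_def)

lemma seg0: "x \<in> U \<Longrightarrow> seg x = 0 \<Longrightarrow> cop x = 0 \<and> org x \<in> base"
  using decode_in by (fastforce simp: nodes_def)

lemma decode_eqI: "x \<in> U \<Longrightarrow> y \<in> U \<Longrightarrow> seg x = seg y \<Longrightarrow> cop x = cop y \<Longrightarrow> org x = org y \<Longrightarrow> x = y"
  using decode by (auto simp: bij_betw_def dest: inj_onD)

lemma obtain_node:
  assumes "(j, i, a) \<in> nodes"
  obtains u where "u \<in> U" "seg u = j" "cop u = i" "org u = a"
proof -
  have "(j, i, a) \<in> (\<lambda>u. (seg u, cop u, org u)) ` U"
    using decode assms by (simp add: bij_betw_def)
  then show ?thesis
    using that by auto
qed

lemma same_commute: "same x y \<longleftrightarrow> same y x"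
  by (auto simp: same_def)

lemma same_trans: "same x y \<Longrightarrow> same y z \<Longrightarrow> same x z"
  by (auto simp: same_def)

lemma pos_abs: "\<bar>pos x\<bar> = int (seg x)"
  by (simp add: pos_def)

lemma lin_asym: "lin x y \<Longrightarrow> \<not> lin y x"
  by (auto simp: lin_def)

lemma lin_trans: "lin x y \<Longrightarrow> lin y z \<Longrightarrow> lin x z"
  by (auto simp: lin_def)

text \<open>The absolute value of \<open>pos\<close> recovers the segment, and the enumeration of
  cliques recovers the clique, so a complete tie means one and the same copied clique.\<close>

lemma lin_total:
  assumes "x \<in> U" "y \<in> U" "\<not> same x y"
  shows "lin x y \<or> lin y x"
proof (rule ccontr)
  assume no: "\<not> (lin x y \<or> lin y x)"
  let ?C = "cl A ` (base \<union> common)"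
  have eq: "pos x = pos y" "cop x = cop y"
    "to_nat_on ?C (cl A (org x)) = to_nat_on ?C (cl A (org y))"
    using no by (auto simp: lin_def)
  have "countable ?C"
    using base_card common_card by (simp add: countable_finite)
  then have "cl A (org x) = cl A (org y)"
    using eq(3) org_base_common[OF assms(1)] org_base_common[OF assms(2)]
    by (meson imageI inj_onD inj_on_to_nat_on)
  moreover have "seg x = seg y"
    using eq(1) pos_abs[of x] pos_abs[of y] by simp
  ultimately show False
    using eq(2) assms(3) by (simp add: same_def)
qed

lemma lin_same: "same x x' \<Longrightarrow> same y y' \<Longrightarrow> lin x y \<longleftrightarrow> lin x' y'"
  by (simp add: lin_def same_def pos_def)

lemma prec_same:
  assumes "x \<in> U" "x' \<in> U" "y \<in> U" "y' \<in> U" "same x x'" "same y y'"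
  shows "prec (org x) (org y) \<longleftrightarrow> prec (org x') (org y')"
proof -
  have "profile (org u) = profile (org v)" if "u \<in> U" "v \<in> U" "same u v" for u v
    using that profile_cl[of "org v" "org u"] org_in self_in_cl[OF org_in[of u]] by (auto simp: same_def)
  then show ?thesis
    using assms by (simp add: prec_def)
qed

lemma ord_same:
  assumes "x \<in> U" "x' \<in> U" "y \<in> U" "y' \<in> U" "same x x'" "same y y'"
  shows "ord x y \<longleftrightarrow> ord x' y'"
  unfolding ord_def
  using prec_same[OF assms] prec_same[OF assms(3,4,1,2,6,5)] lin_same[OF assms(5,6)] by simp

lemma ord_asym: "ord x y \<Longrightarrow> \<not> ord y x"
  using lin_asym by (auto simp: ord_def)

lemma ord_trans: "ord x y \<Longrightarrow> ord y z \<Longrightarrow> ord x z"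
  unfolding ord_def using prec_trans lin_trans by blast

section \<open>Existence and choice of source pairs\<close>

lemma good_commute: "good x y a b \<longleftrightarrow> good y x b a"
  unfolding good_def by blast

lemma lt_imp_tr: "lt a b \<Longrightarrow> tr A a b \<and> \<not> tr A b a \<and> a \<noteq> b"
  by (auto simp: lt_def)

text \<open>\<open>prec\<close> in both directions would put each of the two elements below itself,
  which a royal element forbids. Hence \<open>ord\<close> agrees here with the order of
  \<open>A\<close> and the original pair can be kept.\<close>

lemma good_royal:
  assumes "x \<in> U" "y \<in> U" "royal (org x) \<or> royal (org y)" "lt (org x) (org y)"
  shows "good x y (org x) (org y)"
proof -
  have "prec (org x) (org y)"
    using lt_imp_prec org_in assms by blast
  moreover have "\<not> prec (org x) (org x) \<or> \<not> prec (org y) (org y)"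
    using assms(3) by (auto simp: royal_def)
  ultimately have "ord x y" "\<not> ord y x"
    using prec_trans by (auto simp: ord_def)
  moreover have "\<not> demand x y" "\<not> demand y x"
    using assms(3) by (auto simp: demand_def)
  ultimately show ?thesis
    using lt_imp_tr[OF assms(4)] org_in[OF assms(1)] org_in[OF assms(2)] by (simp add: good_def)
qed

text \<open>\<open>y\<close> shares the profile of the witness, so \<open>prec\<close> holds in the
  required direction. If it holds both ways, \<open>pos\<close> decides: \<open>pos y\<close> is
  plus or minus \<open>seg y\<close> according to the direction, while
  \<open>\<bar>pos x\<bar>\<close> is smaller.\<close>

lemma good_demand:
  assumes xy: "x \<in> U" "y \<in> U" and d: "demand x y"
  shows "good x y (org x) (w (cop y) (org x))"
proof -
  define v where "v = w (cop y) (org x)"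
  have c: "\<not> royal (org x)" "\<not> royal (org y)" "seg x < seg y" "cop y < m" "org y = twin v"
    using d by (auto simp: demand_def v_def)
  have v: "v \<in> univ A"
    using w_in[OF c(4) org_in[OF xy(1)]] by (simp add: v_def)
  have v_lt: "if fwd (cop y) then lt (org x) v else lt v (org x)"
    using w_lt[OF c(4) org_in[OF xy(1)]] by (simp add: v_def)
  have prec_v: "prec (org x) v = prec (org x) (org y)" "prec v (org x) = prec (org y) (org x)"
    using profile_twin[OF v] c(5) by (simp_all add: prec_def)
  have ord: "(tr A (org x) v \<longleftrightarrow> ord x y) \<and> (tr A v (org x) \<longleftrightarrow> ord y x) \<and> org x \<noteq> v"
  proof (cases "fwd (cop y)")
    case True
    then have "prec (org x) (org y)"
      using v_lt lt_imp_prec[OF org_in[OF xy(1)] v] prec_v by simp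
    moreover have "pos x < pos y"
      using pos_abs[of x] c(3) True by (simp add: pos_def split: if_splits)
    ultimately have "ord x y"
      by (simp add: ord_def lin_def)
    then show ?thesis
      using True v_lt lt_imp_tr[of "org x" v] ord_asym[of x y] by simp
  next
    case False
    then have "prec (org y) (org x)"
      using v_lt lt_imp_prec[OF v org_in[OF xy(1)]] prec_v by simp
    moreover have "pos y < pos x"
      using pos_abs[of x] c(3,4) False by (simp add: pos_def split: if_splits)
    ultimately have "ord y x"
      by (simp add: ord_def lin_def)
    then show ?thesis
      using False v_lt lt_imp_tr[of v "org x"] ord_asym[of y x] by auto
  qed
  have "\<not> demand y x"
    using c(3) by (simp add: demand_def)
  then show ?thesis
    using ord v org_in[OF xy(1)] c(1,2) twin(2)[OF v] c(5) by (simp add: good_def flip: v_def)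
qed

lemma good_ord:
  assumes xy: "x \<in> U" "y \<in> U" and ord: "ord x y" and d: "\<not> demand x y" "\<not> demand y x"
    and free: "\<not> ((royal (org x) \<or> royal (org y)) \<and> (lt (org x) (org y) \<or> lt (org y) (org x)))"
  shows "\<exists>b. good x y (org x) b"
proof -
  have "prec (org x) (org y)"
    using ord by (simp add: ord_def)
  then obtain b where b: "b \<in> univ A" "lt (org x) b" "tp1 \<sigma> A b = tp1 \<sigma> A (org y)"
    using prec_realizes[OF org_in[OF xy(2)]] by blast
  then have "good x y (org x) b"
    using d free ord ord_asym[OF ord] org_in[OF xy(1)] lt_imp_tr[OF b(2)] by (auto simp: good_def)
  then show ?thesis ..
qed

text \<open>As \<open>lin\<close> is total, \<open>prec\<close> fails both ways, so any element with
  the profile of \<open>org y\<close> outside the clique of \<open>org x\<close> is unrelated to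
  \<open>org x\<close> in \<open>A\<close>. It remains to find one with the 1-type of
  \<open>org y\<close>.\<close>

lemma good_incomparable:
  assumes xy: "x \<in> U" "y \<in> U" and "\<not> same x y" and "\<not> ord x y" "\<not> ord y x"
    and d: "\<not> demand x y" "\<not> demand y x"
    and free: "\<not> ((royal (org x) \<or> royal (org y)) \<and> (lt (org x) (org y) \<or> lt (org y) (org x)))"
  shows "\<exists>b. good x y (org x) b"
proof -
  have np: "\<not> prec (org x) (org y)" "\<not> prec (org y) (org x)"
    using assms(4,5) lin_total[OF xy assms(3)] by (auto simp: ord_def)
  have x: "org x \<in> univ A" and y: "org y \<in> univ A"
    using org_in xy by auto
  obtain b where b: "b \<in> univ A" "b \<notin> cl A (org x)" "tp1 \<sigma> A b = tp1 \<sigma> A (org y)"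
    "profile b = profile (org y)"
  proof (cases "cl A (org x) = cl A (org y)")
    case True
    then have prof: "profile (org x) = profile (org y)"
      using profile_cl[OF y, of "org x"] self_in_cl[OF x] by simp
    \<comment> \<open>Segment 0 contains each clique only once. A clique occurring twice therefore
      comes from \<open>common\<close> and is not royal, and failing \<open>prec\<close> to itself
      it has a companion clique with the same profile.\<close>
    have "seg x \<noteq> 0 \<or> seg y \<noteq> 0"
      using seg0[OF xy(1)] seg0[OF xy(2)] True assms(3) unfolding same_def by metis
    then have "\<not> royal (org x)"
      using org_common common_not_royal xy royal_profile[OF x y prof] by blast
    moreover have "\<not> prec (org x) (org x)"
      using np(1) prof by (simp add: prec_def)
    ultimately obtain d where d: "d \<in> univ A" "profile d = profile (org x)" "d \<notin> cl A (org x)"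
      by (auto simp: royal_def)
    obtain b where b: "b \<in> cl A d" "tp1 \<sigma> A b = tp1 \<sigma> A (org y)"
      using profile_realizes[OF y, of d] d prof by auto
    have "b \<notin> cl A (org x)"
      using cl_eq[OF trans_A d(1) b(1)] cl_eq[OF trans_A x, of b] d self_in_cl[OF d(1)] by blast
    then show ?thesis
      using that[of b] b cl_subset profile_cl[OF d(1) b(1)] d(2) prof by auto
  next
    case False
    then have "org y \<notin> cl A (org x)"
      using cl_eq[OF trans_A x] by blast
    then show ?thesis
      using that[of "org y"] y by blast
  qed
  have "\<not> lt (org x) b" "\<not> lt b (org x)"
    using lt_imp_prec[OF x b(1)] lt_imp_prec[OF b(1) x] np b(4) by (auto simp: prec_def)
  then have "\<not> tr A (org x) b" "\<not> tr A b (org x)"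
    using b(1,2) by (auto simp: lt_def cl_def)
  moreover have "b \<noteq> org x"
    using b(2) self_in_cl[OF x] by blast
  ultimately have "good x y (org x) b"
    using assms(4,5) d free x b by (auto simp: good_def)
  then show ?thesis ..
qed

lemma good_exists:
  assumes xy: "x \<in> U" "y \<in> U" "\<not> same x y"
  shows "\<exists>a b. good x y a b"
proof -
  have nsame: "\<not> same y x"
    using assms(3) same_commute by blast
  consider "royal (org x) \<or> royal (org y)" "lt (org x) (org y)"
    | "royal (org y) \<or> royal (org x)" "lt (org y) (org x)"
    | "demand x y" | "demand y x"
    | "\<not> ((royal (org x) \<or> royal (org y)) \<and> (lt (org x) (org y) \<or> lt (org y) (org x)))"
      "\<not> demand x y" "\<not> demand y x"
    by blast
  then show ?thesis
  proof cases
    case 5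
    then show ?thesis
      using good_ord[of x y] good_ord[of y x] good_incomparable[of x y] xy nsame good_commute by blast
  qed (use good_royal[of x y] good_royal[of y x] good_demand[of x y] good_demand[of y x] xy
      good_commute in blast)+
qed

lemma good_src:
  assumes "x \<in> U" "y \<in> U" "\<not> same x y"
  shows "good x y (src x y) (src y x)"
proof -
  let ?r = "SOME r. good x y (r (key x y)) (r (key y x))"
  have "key x y \<noteq> key y x"
    using assms(3) by (auto simp: key_def same_def)
  moreover obtain a b where "good x y a b"
    using good_exists[OF assms] by blast
  ultimately have "\<exists>r. good x y (r (key x y)) (r (key y x))"
    \<comment> \<open>Equal keys would mean equal segment, copy and origin, hence
      \<open>same x y\<close>; as the keys differ, a function can take both values
      independently.\<close>
    by (intro exI[of _ "\<lambda>u. if u = key x y then a else b"]) simp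
  then have "good x y (?r (key x y)) (?r (key y x))"
    by (rule someI_ex)
  moreover have "src x y = ?r (key x y)"
    using assms(3) by (simp add: src_def)
  \<comment> \<open>By the symmetry of \<open>good\<close>, the choice for \<open>y, x\<close> is
    made from the very same predicate and returns the same function.\<close>
  moreover have "src y x = ?r (key y x)"
    using assms(3) same_commute[of x y] good_commute[of x y] by (simp add: src_def)
  ultimately show ?thesis
    by simp
qed

lemma src_same: "same x y \<Longrightarrow> src x y = org x"
  by (simp add: src_def)

lemma same_refl: "same x x"
  by (simp add: same_def)

lemma src_in: "x \<in> U \<Longrightarrow> y \<in> U \<Longrightarrow> src x y \<in> univ A"
  using good_src[of x y] src_same[of x y] org_in by (cases "same x y") (auto simp: good_def)

lemma tp2_copy:
  assumes "x \<in> U" "y \<in> U"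
  shows "tp2 \<sigma> (weave A U src) x y = tp2 \<sigma> A (src x y) (src y x)"
proof (rule tp2_weave)
  have "tp1 \<sigma> A (src u v) = tp1 \<sigma> A (src u u)" if "u \<in> U" "v \<in> U" for u v
    using that good_src[of u v] src_same[of u v] src_same[OF same_refl[of u]]
    by (cases "same u v") (auto simp: good_def)
  then show "tp1 \<sigma> A (src x y) = tp1 \<sigma> A (src x x)" "tp1 \<sigma> A (src y x) = tp1 \<sigma> A (src y y)"
    using assms by blast+
  show "src x y = src y x \<longleftrightarrow> x = y"
  proof (cases "same x y")
    case True
    then show ?thesis
      using assms decode_eqI[of x y] same_commute[of x y] by (auto simp: src_same same_def)
  next
    case False
    then show ?thesis
      using good_src[OF assms] by (auto simp: good_def same_refl)
  qed
qed

text \<open>All ingredients of \<open>src\<close> look at segment numbers only through order and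
  vanishing, and equal predicates and keys give equal choices. This uniformity makes the segments
  similar.\<close>

lemma src_shift:
  assumes "cop x = cop x'" "org x = org x'" "cop y = cop y'" "org y = org y'"
    and "seg x < seg y \<longleftrightarrow> seg x' < seg y'" "seg y < seg x \<longleftrightarrow> seg y' < seg x'"
    and "seg x = 0 \<longleftrightarrow> seg x' = 0" "seg y = 0 \<longleftrightarrow> seg y' = 0"
  shows "src x y = src x' y'"
proof -
  have "seg x = seg y \<longleftrightarrow> seg x' = seg y'"
    using assms(5,6) by linarith
  \<comment> \<open>Positions carry signs: between opposite signs the comparison depends only on
    whether the segments are 0, and between equal signs only on their order.\<close>
  have signed: "(if e then - int a else int a) < (if f then - int b else int b) \<longleftrightarrow>
      (if e then - int a' else int a') < (if f then - int b' else int b')"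
    if "a < b \<longleftrightarrow> a' < b'" "b < a \<longleftrightarrow> b' < a'" "a = 0 \<longleftrightarrow> a' = 0" "b = 0 \<longleftrightarrow> b' = 0"
    for e f and a b a' b' :: nat
    using that by (cases e; cases f; simp only: if_True if_False; presburger)
  have "pos x < pos y \<longleftrightarrow> pos x' < pos y'" "pos y < pos x \<longleftrightarrow> pos y' < pos x'"
    unfolding pos_def assms(1,3) using assms(5-8) by (intro signed; simp)+
  moreover from this have "pos x = pos y \<longleftrightarrow> pos x' = pos y'" "pos y = pos x \<longleftrightarrow> pos y' = pos x'"
    by linarith+
  ultimately have "lin x y \<longleftrightarrow> lin x' y'" "lin y x \<longleftrightarrow> lin y' x'"
    by (simp_all add: lin_def assms(1-4))
  then have "ord x y \<longleftrightarrow> ord x' y'" "ord y x \<longleftrightarrow> ord y' x'"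
    by (simp_all add: ord_def assms(1-4))
  moreover have "demand x y \<longleftrightarrow> demand x' y'" "demand y x \<longleftrightarrow> demand y' x'"
    by (simp_all add: demand_def assms(1-6))
  ultimately have "good x y = good x' y'"
    by (simp add: good_def fun_eq_iff assms(1-4))
  moreover have "key x y = key x' y'" "key y x = key y' x'"
    by (simp_all add: key_def assms(1-6))
  moreover have "same x y \<longleftrightarrow> same x' y'"
    using \<open>seg x = seg y \<longleftrightarrow> seg x' = seg y'\<close> by (simp add: same_def assms(1-4))
  ultimately show ?thesis
    by (simp add: src_def assms(1-4))
qed

lemma tr_copy:
  assumes "x \<in> U" "y \<in> U"
  shows "tr (weave A U src) x y \<longleftrightarrow> (if same x y then tr A (org x) (org y) else ord x y)"
  using good_src[OF assms] same_commute[of x y] by (auto simp: weave_def src_same good_def)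

text \<open>Inside a copied clique \<open>T\<close> is that of \<open>A\<close>; between different
  ones it is \<open>ord\<close>, which is transitive, asymmetric and invariant under
  \<open>same\<close>.\<close>

lemma transp_on_copy: "transp_on U (tr (weave A U src))"
proof (rule transp_onI)
  fix x y z
  assume xyz: "x \<in> U" "y \<in> U" "z \<in> U"
    and xy: "tr (weave A U src) x y" and yz: "tr (weave A U src) y z"
  consider "same x y" "same y z" | "same x y" "\<not> same y z" | "\<not> same x y" "same y z"
    | "\<not> same x y" "\<not> same y z"
    by blast
  then show "tr (weave A U src) x z"
  proof cases
    case 1
    then have "tr A (org x) (org z)"
      using xy yz xyz org_in trans[of "org x" "org y" "org z"] by (simp add: tr_copy)
    then show ?thesis
      using same_trans[OF 1] xyz by (simp add: tr_copy)
  next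
    case 2
    then have "\<not> same x z"
      using same_trans[of y x z] same_commute[of x y] by blast
    moreover have "ord x z"
      using 2 yz xyz ord_same[of x y z z] same_refl by (simp add: tr_copy)
    ultimately show ?thesis
      using xyz by (simp add: tr_copy)
  next
    case 3
    then have "\<not> same x z"
      using same_trans[of x z y] same_commute[of y z] by blast
    moreover have "ord x z"
      using 3 xy xyz ord_same[of x x y z] same_refl by (simp add: tr_copy)
    ultimately show ?thesis
      using xyz by (simp add: tr_copy)
  next
    case 4
    then have ord: "ord x y" "ord y z"
      using xy yz xyz by (simp_all add: tr_copy)
    have "\<not> same x z"
      using ord_same[of x z y y] ord ord_asym xyz same_refl by blast
    then show ?thesis
      using ord_trans[OF ord] xyz by (simp add: tr_copy)
  qed
qed

end

section \<open>Witnesses in the copied structure\<close>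

context segmented_copy
begin

text \<open>If either element is royal, the actual witness belongs to \<open>base\<close>, and
  \<open>good\<close> preserves the original pair.\<close>

lemma royal_witness_in_copy:
  assumes x: "x \<in> U" and i: "i < m" and roy: "royal (org x) \<or> royal (w i (org x))"
  obtains y where "y \<in> U" "seg y = 0" "tp2 \<sigma> (weave A U src) x y = tp2 \<sigma> A (org x) (w i (org x))"
proof -
  define v where "v = w i (org x)"
  have v: "v \<in> univ A" "lt (org x) v \<or> lt v (org x)"
    using w_in[OF i org_in[OF x]] w_lt[OF i org_in[OF x]] by (auto simp: v_def split: if_splits)
  have "v \<in> base"
  proof (cases "royal v")
    case False
    then have "royal (org x)"
      using roy by (simp add: v_def)
    then show ?thesis
      using i org_in[OF x] self_in_cl[OF v(1)] by (auto simp: base_def v_def)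
  qed (simp add: base_def v)
  then obtain y where y: "y \<in> U" "seg y = 0" "org y = v"
    using obtain_node[of 0 0 v] by (auto simp: nodes_def)
  have "\<not> same x y"
  proof
    assume "same x y"
    then have "v \<in> cl A (org x)"
      using self_in_cl[OF v(1)] y(3) by (simp add: same_def)
    then show False
      using v(2) by (auto simp: lt_def cl_def)
  qed
  then have "src x y = org x" "src y x = v"
    using good_src[OF x y(1)] roy v(2) y(3) by (auto simp: good_def v_def)
  then show ?thesis
    using that[OF y(1,2)] tp2_copy[OF x y(1)] by (simp add: v_def)
qed

text \<open>With neither element royal, the twin of the witness in copy \<open>i\<close> of the next
  segment is subject to \<open>demand\<close>, so the pair receives the 2-type of the actual
  witness.\<close>

lemma witness_in_next_segment:
  assumes x: "x \<in> U" and i: "i < m" and seg: "seg x < 3"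
    and no: "\<not> royal (org x)" "\<not> royal (w i (org x))"
  obtains y where "y \<in> U" "seg y = Suc (seg x)"
    "tp2 \<sigma> (weave A U src) x y = tp2 \<sigma> A (org x) (w i (org x))"
proof -
  define v where "v = w i (org x)"
  have v: "v \<in> univ A"
    using w_in[OF i org_in[OF x]] by (simp add: v_def)
  have com: "twin v \<in> common"
    using twin_in_common[OF v] no by (simp add: v_def)
  then obtain y where y: "y \<in> U" "seg y = Suc (seg x)" "cop y = i" "org y = twin v"
    using obtain_node[of "Suc (seg x)" i "twin v"] seg i by (auto simp: nodes_def)
  have "demand x y"
    using y no i common_not_royal[OF com] by (simp add: demand_def v_def)
  moreover have "\<not> same x y"
    using y by (simp add: same_def)
  ultimately have "src x y = org x" "src y x = v"
    using good_src[OF x y(1)] y(3) by (auto simp: good_def v_def)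
  then show ?thesis
    using that[OF y(1,2)] tp2_copy[OF x y(1)] by (simp add: v_def)
qed

text \<open>\<open>base\<close> and \<open>common\<close> are unions of cliques, so cliques are
  copied whole and with their inner 2-types.\<close>

lemma clique_in_copy:
  assumes x: "x \<in> U" and b: "b \<in> cl A (org x)"
  obtains y where "y \<in> U" "tp2 \<sigma> (weave A U src) x y = tp2 \<sigma> A (org x) b"
proof -
  have "(seg x, cop x, b) \<in> nodes"
    using decode_in[OF x] b base_cl[of "org x"] common_cl[of "org x"] by (auto simp: nodes_def)
  then obtain y where y: "y \<in> U" "seg y = seg x" "cop y = cop x" "org y = b"
    using obtain_node by blast
  then have "same x y" "same y x"
    using cl_eq[OF trans_A org_in[OF x] b] by (simp_all add: same_def)
  then show ?thesis
    using that[OF y(1)] tp2_copy[OF x y(1)] y(4) by (simp add: src_same)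
qed

section \<open>The segments of the copy and their similarity\<close>

definition segment :: "nat \<Rightarrow> 'u set" where
  "segment j = {u \<in> U. seg u = j}"

definition move :: "nat \<Rightarrow> 'u \<Rightarrow> 'u" where
  "move j u = (SOME v. v \<in> U \<and> seg v = j \<and> cop v = cop u \<and> org v = org u)"

lemma move:
  assumes "u \<in> U" "seg u \<noteq> 0" "1 \<le> j" "j \<le> 3"
  shows "move j u \<in> U" "seg (move j u) = j" "cop (move j u) = cop u" "org (move j u) = org u"
proof -
  have "(j, cop u, org u) \<in> nodes"
    using decode_in[OF assms(1)] assms(2-4) by (auto simp: nodes_def)
  then obtain v where "v \<in> U" "seg v = j" "cop v = cop u" "org v = org u"
    using obtain_node by blast
  then have "\<exists>v. v \<in> U \<and> seg v = j \<and> cop v = cop u \<and> org v = org u"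
    by blast
  from someI_ex[OF this] show "move j u \<in> U" "seg (move j u) = j" "cop (move j u) = cop u"
    "org (move j u) = org u"
    by (simp_all add: move_def)
qed

lemma bij_move:
  assumes "1 \<le> i" "i \<le> 3" "1 \<le> j" "j \<le> 3"
  shows "bij_betw (move j) (segment i) (segment j)"
proof (rule bij_betwI)
  show "move j \<in> segment i \<rightarrow> segment j" "move i \<in> segment j \<rightarrow> segment i"
    using move assms by (auto simp: segment_def)
  have inv: "move l (move l' x) = x" if "x \<in> U" "seg x = l" "1 \<le> l" "l \<le> 3" "1 \<le> l'" "l' \<le> 3" for l l' x
  proof -
    have m: "move l' x \<in> U" "seg (move l' x) \<noteq> 0" "cop (move l' x) = cop x" "org (move l' x) = org x"
      using move[of x l'] that by auto
    show ?thesis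
      using move[OF m(1,2), of l] m that by (intro decode_eqI) auto
  qed
  show "move i (move j x) = x" if "x \<in> segment i" for x
    using that assms by (intro inv) (auto simp: segment_def)
  show "move j (move i x) = x" if "x \<in> segment j" for x
    using that assms by (intro inv) (auto simp: segment_def)
qed

lemma tp2_shift:
  assumes "x \<in> U" "y \<in> U" "x' \<in> U" "y' \<in> U"
    and "cop x = cop x'" "org x = org x'" "cop y = cop y'" "org y = org y'"
    and "seg x < seg y \<longleftrightarrow> seg x' < seg y'" "seg y < seg x \<longleftrightarrow> seg y' < seg x'"
    and "seg x = 0 \<longleftrightarrow> seg x' = 0" "seg y = 0 \<longleftrightarrow> seg y' = 0"
  shows "tp2 \<sigma> (weave A U src) x y = tp2 \<sigma> (weave A U src) x' y'"
  using src_shift[OF assms(5-12)] src_shift[OF assms(7,8,5,6,10,9,12,11)] assms(1-4)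
  by (simp add: tp2_copy)

lemma iso_move:
  assumes "1 \<le> i" "i \<le> 3" "1 \<le> j" "j \<le> 3"
  shows "iso \<sigma> (move j) (restrict_struct (weave A U src) (segment i))
    (restrict_struct (weave A U src) (segment j))"
proof (rule iso_restrictI[OF bij_move[OF assms]])
  fix a b
  assume "a \<in> segment i" "b \<in> segment i"
  then show "tp2 \<sigma> (weave A U src) (move j a) (move j b) = tp2 \<sigma> (weave A U src) a b"
    using assms move[of a j] move[of b j] by (intro tp2_shift) (auto simp: segment_def)
qed

lemma iso_id: "iso \<sigma> id (restrict_struct B V) (restrict_struct B V)"
  by (rule iso_restrictI) auto

lemma tp2_move_right:
  assumes "b \<in> segment 0" "c \<in> segment i" "1 \<le> i" "1 \<le> j" "j \<le> 3"
  shows "tp2 \<sigma> (weave A U src) b c = tp2 \<sigma> (weave A U src) b (move j c)"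
  using assms move[of c j] by (intro tp2_shift) (auto simp: segment_def)

lemma tp2_move_both:
  assumes "b \<in> segment i" "c \<in> segment i'" "1 \<le> i" "i < i'" "1 \<le> j" "j < j'" "j' \<le> 3"
  shows "tp2 \<sigma> (weave A U src) b c = tp2 \<sigma> (weave A U src) (move j b) (move j' c)"
  using assms move[of b j] move[of c j'] by (intro tp2_shift) (auto simp: segment_def)

lemma move_id: "x \<in> segment i \<Longrightarrow> 1 \<le> i \<Longrightarrow> i \<le> 3 \<Longrightarrow> move i x = x"
  using move[of x i] by (intro decode_eqI) (auto simp: segment_def)

text \<open>The coherent identification is \<open>move 2\<close> followed by \<open>move 3\<close>;
  both keep copy number and origin. In the last similarity the identity is \<open>move 3\<close> on
  segment 3.\<close>

lemma similar_segments_copy: "similar_segments \<sigma> (weave A U src) segment"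
proof -
  have disj: "segment i \<inter> segment j = {}" if "i \<noteq> j" for i j
    using that by (auto simp: segment_def)
  have "segs_via \<sigma> (weave A U src) id (move 2) (segment 0) (segment 1) (segment 0) (segment 2)"
    unfolding segs_via_def using disj iso_id iso_move[of 1 2] tp2_move_right[of _ _ 1 2] by simp
  moreover have "segs_via \<sigma> (weave A U src) id (move 3) (segment 0) (segment 2) (segment 0) (segment 3)"
    unfolding segs_via_def using disj iso_id iso_move[of 2 3] tp2_move_right[of _ _ 2 3] by simp
  moreover have "segs_via \<sigma> (weave A U src) (move 2) (move 3) (segment 1) (segment 2) (segment 2) (segment 3)"
    unfolding segs_via_def using disj iso_move[of 1 2] iso_move[of 2 3] tp2_move_both[of _ 1 _ 2 2 3] by simp
  moreover have "segs_via \<sigma> (weave A U src) (move 2) id (segment 1) (segment 3) (segment 2) (segment 3)"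
    unfolding segs_via_def using disj iso_id iso_move[of 1 2] tp2_move_both[of _ 1 _ 3 2 3] move_id[of _ 3]
    by simp
  ultimately show ?thesis
    unfolding similar_segments_def by blast
qed

lemma partition_copy: "partition_on U {segment 0, segment 1, segment 2, segment 3}"
proof -
  have "c0 \<in> base" "twin c0 \<in> common"
    using self_in_cl[OF c0(1)] twin_in_common[OF c0] by (auto simp: base_def)
  then have "\<exists>i a. (j, i, a) \<in> nodes" if "j \<le> 3" for j
    using that by (cases "j = 0") (auto simp: nodes_def)
  then have ne: "segment j \<noteq> {}" if "j \<le> 3" for j
    using that obtain_node unfolding segment_def by blast
  have "{} \<notin> {segment 0, segment 1, segment 2, segment 3}"
    using ne[of 0] ne[of 1] ne[of 2] ne[of 3] by auto
  moreover have "seg u \<le> 3" if "u \<in> U" for u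
    using decode_in[OF that] by (auto simp: nodes_def)
  then have "seg u = 0 \<or> seg u = 1 \<or> seg u = 2 \<or> seg u = 3" if "u \<in> U" for u
    using that by fastforce
  then have "segment 0 \<union> segment 1 \<union> segment 2 \<union> segment 3 = U"
    unfolding segment_def by blast
  then have "\<Union> {segment 0, segment 1, segment 2, segment 3} = U"
    by auto
  moreover have "segment i \<inter> segment j = {}" if "segment i \<noteq> segment j" for i j
    using that by (auto simp: segment_def)
  then have "disjoint {segment 0, segment 1, segment 2, segment 3}"
    unfolding disjoint_def by blast
  ultimately show ?thesis
    unfolding partition_on_def by blast
qed

lemma card_copy:
  "finite U" "card U \<le> card base + 3 * (m + 1) * card common"
  using nodes_card bij_betw_finite[OF decode] bij_betw_same_card[OF decode] by auto

end

section \<open>The two directions of the equivalence\<close>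

lemma holds_guard_dir_neq: "holds A a b (guard_dir d \<psi>) \<Longrightarrow> b \<noteq> a"
  by (auto simp: holds_guard_dir split: if_splits)

lemma in_W_iff: "b \<in> W A g a \<longleftrightarrow> b \<in> univ A \<and> holds A a b (guard_dir (fst g) (snd g))"
  using holds_guard_dir_neq[of A a b "fst g" "snd g"] by (auto simp: W_def)

text \<open>The finite condition of the theorem, with the size bound as a parameter.\<close>

definition small_segmentation ::
    "'p symb set \<Rightarrow> 'p fo2 \<Rightarrow> (dir \<times> 'p fo2) list \<Rightarrow> 'p fo2 list \<Rightarrow> nat \<Rightarrow> ('p, 'a) struct \<Rightarrow>
     (nat \<Rightarrow> 'a set) \<Rightarrow> bool" where
  "small_segmentation \<sigma> \<psi>0 gs ds n A S \<longleftrightarrow>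
     univ A \<noteq> {} \<and> (\<forall>j\<le>3. S j \<subseteq> univ A) \<and> finite (univ A) \<and> card (univ A) \<le> n \<and>
     (S 0 = univ A \<and> S 1 = {} \<and> S 2 = {} \<and> S 3 = {} \<or>
      partition_on (univ A) {S 0, S 1, S 2, S 3} \<and> similar_segments \<sigma> A S) \<and>
     (\<forall>a\<in>univ A. \<forall>b\<in>univ A. entails (tp2 \<sigma> A a b) \<psi>0) \<and>
     transp_on (univ A) (tr A) \<and>
     (\<forall>j\<in>{0, 1, 2}. \<forall>a\<in>S j. \<forall>i<length gs.
        W A (gs ! i) a \<inter> S 0 = {} \<longrightarrow> W A (gs ! i) a \<inter> S (j + 1) \<noteq> {}) \<and>
     (\<forall>a\<in>univ A. \<forall>i<length ds. \<exists>b\<in>Cl A a. holds A a b (guard_both (ds ! i)))"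

text \<open>If \<open>S 0\<close> is everything, \<open>A\<close> is itself a model; otherwise the
  four segments are unfolded.\<close>

lemma satisfiable_of_small_segmentation:
  fixes A :: "('p, 'a :: infinite) struct"
  assumes nd: "normal_data \<psi>0 gs ds" and sym: "symbols (normal_sentence \<psi>0 gs ds) \<subseteq> \<sigma>" and T: "T \<in> \<sigma>"
    and seg: "small_segmentation \<sigma> \<psi>0 gs ds n A S"
  shows "satisfiable TYPE('a) (normal_sentence \<psi>0 gs ds)"
proof -
  note nc = normal_data_components[OF nd sym]
  have trans: "transp_on (univ A) (tr A)" and ne: "univ A \<noteq> {}" and fin: "finite (univ A)"
    and S: "S 0 = univ A \<or> partition_on (univ A) {S 0, S 1, S 2, S 3} \<and> similar_segments \<sigma> A S"
    and wit: "\<forall>j\<in>{0, 1, 2}. \<forall>a\<in>S j. \<forall>i<length gs.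
        W A (gs ! i) a \<inter> S 0 = {} \<longrightarrow> W A (gs ! i) a \<inter> S (j + 1) \<noteq> {}"
    and wit': "\<forall>a\<in>univ A. \<forall>i<length ds. \<exists>b\<in>Cl A a. holds A a b (guard_both (ds ! i))"
    and ent: "\<forall>a\<in>univ A. \<forall>b\<in>univ A. entails (tp2 \<sigma> A a b) \<psi>0"
    using seg unfolding small_segmentation_def by blast+
  have all: "holds A a b \<psi>0" if "a \<in> univ A" "b \<in> univ A" for a b
    using ent that unfolding entails_tp2_iff[OF nc(1,2)] by blast
  have gam: "\<exists>b\<in>univ A. holds A a b (guard_dir (fst (gs ! i)) (snd (gs ! i)))"
    if "a \<in> S 0 \<union> S 1" "i < length gs" for a i
  proof -
    have "W A (gs ! i) a \<noteq> {}"
      using wit that by blast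
    then show ?thesis
      by (auto simp: in_W_iff)
  qed
  have del: "\<exists>b\<in>univ A. holds A a b (guard_both (ds ! i))" if "a \<in> univ A" "i < length ds" for a i
    using wit' that Cl_eq_cl[OF trans that(1)] by (fastforce simp: cl_def)
  from S show ?thesis
  proof (elim disjE conjE)
    assume "S 0 = univ A"
    then have "model A (normal_sentence \<psi>0 gs ds)"
      unfolding model_normal_sentence_iff using ne trans all gam del by blast
    then show ?thesis
      unfolding satisfiable_def by blast
  qed (use satisfiable_of_segments[OF nd sym T fin _ _ trans all gam del] in blast)
qed

text \<open>Each profile then belongs to exactly one clique, so such a structure is small as it
  stands and can serve as \<open>S 0\<close> alone.\<close>

lemma (in typed_order) card_univ_all_royal:
  assumes "\<And>a. a \<in> univ A \<Longrightarrow> royal a" "finite (profile ` univ A)"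
    and "\<And>a. a \<in> univ A \<Longrightarrow> finite (cl A a) \<and> card (cl A a) \<le> k"
  shows "finite (univ A)" "card (univ A) \<le> card (profile ` univ A) * k"
proof -
  define B where "B t = {a \<in> univ A. profile a = t}" for t
  have "finite (B t) \<and> card (B t) \<le> k" if t: "t \<in> profile ` univ A" for t
  proof -
    obtain a where a: "a \<in> univ A" "t = profile a"
      using t by blast
    have "B t = cl A a"
      using assms(1)[OF a(1)] profile_cl[OF a(1)] cl_subset a(2) unfolding B_def royal_def by blast
    then show ?thesis
      using assms(3)[OF a(1)] by simp
  qed
  moreover have "univ A = (\<Union>t\<in>profile ` univ A. B t)"
    by (auto simp: B_def)
  ultimately show "finite (univ A)" "card (univ A) \<le> card (profile ` univ A) * k"
    using finite_card_UN[of "profile ` univ A" B k] assms(2) by metis+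
qed

lemma (in segmented_copy) small_segmentation_copy:
  assumes nd: "normal_data \<psi>0 gs ds" and sym: "symbols (normal_sentence \<psi>0 gs ds) \<subseteq> \<sigma>"
    and mod: "model A (normal_sentence \<psi>0 gs ds)" and m: "m = length gs"
    and w: "\<And>i a. i < m \<Longrightarrow> a \<in> univ A \<Longrightarrow> holds A a (w i a) (guard_dir (fst (gs ! i)) (snd (gs ! i)))"
    and n: "card base + 3 * (m + 1) * card common \<le> n"
  shows "small_segmentation \<sigma> \<psi>0 gs ds n (weave A U src) segment"
proof -
  note nc = normal_data_components[OF nd sym]
  let ?B = "weave A U src"
  have U: "univ ?B = U"
    by (simp add: weave_def)
  have trans: "transp_on (univ ?B) (tr ?B)"
    using transp_on_copy by (simp add: U)
  have W: "y \<in> W ?B (gs ! i) x"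
    if "x \<in> U" "y \<in> U" "i < m" "tp2 \<sigma> ?B x y = tp2 \<sigma> A (org x) (w i (org x))" for x y i
  proof -
    have "i < length gs"
      using that(3) m by simp
    then show ?thesis
      using holds_cong_tp2[OF that(4) nc(3,4)] w[OF that(3) org_in[OF that(1)]] that(2)
      by (simp add: in_W_iff U)
  qed
  have "W ?B (gs ! i) x \<inter> segment 0 \<noteq> {} \<or> W ?B (gs ! i) x \<inter> segment (j + 1) \<noteq> {}"
    if j: "j \<in> {0, 1, 2}" and x: "x \<in> segment j" and "i < length gs" for i j x
  proof (cases "royal (org x) \<or> royal (w i (org x))")
    have i: "i < m"
      using \<open>i < length gs\<close> m by simp
    case True
    then obtain y where "y \<in> U" "seg y = 0" "tp2 \<sigma> ?B x y = tp2 \<sigma> A (org x) (w i (org x))"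
      using royal_witness_in_copy[of x i] x i by (auto simp: segment_def)
    then show ?thesis
      using W[of x y i] x i by (auto simp: segment_def)
  next
    have i: "i < m"
      using \<open>i < length gs\<close> m by simp
    case False
    moreover have "x \<in> U" "seg x = j" "seg x < 3"
      using x j by (auto simp: segment_def)
    ultimately obtain y where "y \<in> U" "seg y = Suc j" "tp2 \<sigma> ?B x y = tp2 \<sigma> A (org x) (w i (org x))"
      using witness_in_next_segment[of x i] i by blast
    then show ?thesis
      using W[of x y i] x i by (auto simp: segment_def)
  qed
  moreover have "\<exists>y\<in>Cl ?B x. holds ?B x y (guard_both (ds ! i))" if x: "x \<in> U" and i: "i < length ds" for x i
  proof -
    obtain b where b: "b \<in> univ A" "holds A (org x) b (guard_both (ds ! i))"
      using mod org_in[OF x] i unfolding model_normal_sentence_iff by blast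
    then have "b \<in> cl A (org x)"
      by (auto simp: holds_guard_both cl_def)
    then obtain y where y: "y \<in> U" "tp2 \<sigma> ?B x y = tp2 \<sigma> A (org x) b"
      using clique_in_copy[OF x] by blast
    then have "holds ?B x y (guard_both (ds ! i))"
      using holds_cong_tp2[OF y(2) nc(5,6)] b i by blast
    moreover from this have "y \<in> cl ?B x"
      using y(1) by (auto simp: holds_guard_both cl_def U)
    ultimately show ?thesis
      using Cl_eq_cl[OF trans, of x] x U by auto
  qed
  moreover have "entails (tp2 \<sigma> ?B x y) \<psi>0" if "x \<in> U" "y \<in> U" for x y
  proof -
    have "holds A (src x y) (src y x) \<psi>0"
      using mod src_in that unfolding model_normal_sentence_iff by blast
    then show ?thesis
      using entails_tp2_iff[OF nc(1,2)] tp2_copy[OF that] by metis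
  qed
  moreover have "U \<noteq> {}" "\<forall>j\<le>3. segment j \<subseteq> U"
    using partition_copy by (auto simp: partition_on_def segment_def)
  moreover have "card U \<le> n"
    using card_copy(2) n by linarith
  ultimately show ?thesis
    unfolding small_segmentation_def U
    using transp_on_copy card_copy(1) partition_copy similar_segments_copy by blast
qed

lemma small_segmentation_of_model:
  fixes A :: "('p, 'a :: infinite) struct"
  assumes nd: "normal_data \<psi>0 gs ds" and sym: "symbols (normal_sentence \<psi>0 gs ds) \<subseteq> \<sigma>" and T: "T \<in> \<sigma>"
    and mod: "model A (normal_sentence \<psi>0 gs ds)" and cliques: "cliques_at_most k A"
    and fin: "finite (splice \<sigma> A ` {B. clique A B})" and card: "card (splice \<sigma> A ` {B. clique A B}) \<le> s"
    and "k \<le> s"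
  shows "\<exists>(B :: ('p, 'a) struct) S. small_segmentation \<sigma> \<psi>0 gs ds (4 * ((length gs + 1) * s\<^sup>2 * k)) B S"
proof -
  note nc = normal_data_components[OF nd sym]
  let ?m = "length gs" and ?guard = "\<lambda>i. guard_dir (fst (gs ! i)) (snd (gs ! i))"
  have A: "univ A \<noteq> {}" "transp_on (univ A) (tr A)"
    using mod unfolding model_normal_sentence_iff by blast+
  interpret typed_order A \<sigma>
    using A by unfold_locales
  have profiles: "finite (profile ` univ A)" "card (profile ` univ A) \<le> s"
    using card_profiles_le[OF T fin] card by linarith+
  have cl: "finite (cl A a) \<and> card (cl A a) \<le> k" if "a \<in> univ A" for a
    using cliques clique_cl[OF trans_A that] by (auto simp: cliques_at_most_def)
  have "card (profile ` univ A) \<noteq> 0"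
    using profiles(1) A(1) by simp
  then have "1 \<le> s"
    using profiles(2) by linarith
  have Pk: "card (profile ` univ A) * k \<le> s * k"
    using profiles(2) by simp
  have "\<forall>i a. \<exists>b. i < ?m \<longrightarrow> a \<in> univ A \<longrightarrow> b \<in> univ A \<and> holds A a b (?guard i)"
    using mod unfolding model_normal_sentence_iff by blast
  then obtain w where w: "i < ?m \<Longrightarrow> a \<in> univ A \<Longrightarrow> w i a \<in> univ A \<and> holds A a (w i a) (?guard i)" for i a
    by metis
  show ?thesis
  proof (cases "\<forall>a\<in>univ A. royal a")
    case True
    define S where "S j = (if j = (0 :: nat) then univ A else {})" for j
    have "s * k * 1 \<le> s * k * (4 * ((?m + 1) * s))"
      using \<open>1 \<le> s\<close> by (intro mult_le_mono2) simp
    then have "s * k \<le> 4 * ((?m + 1) * s\<^sup>2 * k)"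
      by (simp add: power2_eq_square algebra_simps)
    moreover have finite: "finite (univ A)" "card (univ A) \<le> card (profile ` univ A) * k"
      using card_univ_all_royal[of k] True profiles(1) cl by blast+
    ultimately have "card (univ A) \<le> 4 * ((?m + 1) * s\<^sup>2 * k)"
      using Pk by linarith
    moreover have "\<forall>a\<in>univ A. \<forall>b\<in>univ A. entails (tp2 \<sigma> A a b) \<psi>0"
      using mod unfolding model_normal_sentence_iff entails_tp2_iff[OF nc(1,2)] by blast
    moreover have "W A (gs ! i) a \<inter> univ A \<noteq> {}" if "a \<in> univ A" "i < ?m" for a i
      using w[OF that(2,1)] in_W_iff[of "w i a" A "gs ! i" a] by blast
    then have "\<forall>j\<in>{0, 1, 2}. \<forall>a\<in>S j. \<forall>i<?m. W A (gs ! i) a \<inter> S 0 = {} \<longrightarrow> W A (gs ! i) a \<inter> S (j + 1) \<noteq> {}"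
      by (simp add: S_def)
    moreover have "\<exists>b\<in>Cl A a. holds A a b (guard_both (ds ! i))" if a: "a \<in> univ A" and i: "i < length ds" for a i
    proof -
      obtain b where "b \<in> univ A" "holds A a b (guard_both (ds ! i))"
        using mod a i unfolding model_normal_sentence_iff by blast
      then show ?thesis
        using Cl_eq_cl[OF A(2) a] by (auto simp: holds_guard_both cl_def)
    qed
    ultimately have "small_segmentation \<sigma> \<psi>0 gs ds (4 * ((?m + 1) * s\<^sup>2 * k)) A S"
      unfolding small_segmentation_def using A finite(1) by (simp add: S_def)
    then show ?thesis
      by blast
  next
    case False
    then obtain c0 where c0: "c0 \<in> univ A" "\<not> royal c0"
      by blast
    interpret reduction A \<sigma> w ?m "\<lambda>i. fst (gs ! i) = Fwd" c0 k
      using T w c0 cl profiles(1) by unfold_locales (auto simp: holds_guard_dir lt_def)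
    \<comment> \<open>There are finitely many labels, so the copy can be placed inside the type of
      \<open>A\<close>.\<close>
    obtain d :: "'a \<Rightarrow> nat \<times> nat \<times> 'a" and U where "bij_betw d U nodes"
      using infinite_embedding[OF infinite_UNIV countable_finite[OF nodes_card(1)]] by blast
    then interpret segmented_copy A \<sigma> w ?m "\<lambda>i. fst (gs ! i) = Fwd" c0 k
      U "fst \<circ> d" "fst \<circ> snd \<circ> d" "snd \<circ> snd \<circ> d"
      by unfold_locales simp
    \<comment> \<open>One factor \<open>k\<close> for the sizes of witness cliques is replaced by
      \<open>s\<close> using \<open>k \<le> s\<close>; then \<open>1 \<le> s\<close> gives
      \<open>1 + m * s \<le> (m + 1) * s\<close> with \<open>m = length gs\<close>. So segment 0
      takes one quarter of the bound and the other three segments take one quarter each.\<close>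
    have "card base \<le> s * k * (1 + ?m * s)"
      using base_card(2) Pk \<open>k \<le> s\<close> by (meson add_left_mono le_trans mult_le_mono mult_le_mono2)
    also have "\<dots> \<le> s * k * ((?m + 1) * s)"
      using \<open>1 \<le> s\<close> by (intro mult_le_mono2) simp
    also have "\<dots> = (?m + 1) * s\<^sup>2 * k"
      by (simp add: power2_eq_square algebra_simps)
    finally have base: "card base \<le> (?m + 1) * s\<^sup>2 * k" .
    have "(?m + 1) * card common \<le> (?m + 1) * (s * k)"
      using common_card(2) Pk by (intro mult_le_mono2) linarith
    also have "\<dots> \<le> (?m + 1) * (s * s * k)"
      using \<open>1 \<le> s\<close> by (intro mult_le_mono2) simp
    also have "\<dots> = (?m + 1) * s\<^sup>2 * k"
      by (simp add: power2_eq_square algebra_simps)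
    finally have "(?m + 1) * card common \<le> (?m + 1) * s\<^sup>2 * k" .
    then have "card base + 3 * (?m + 1) * card common \<le> 4 * ((?m + 1) * s\<^sup>2 * k)"
      using base unfolding mult.assoc by linarith
    then show ?thesis
      using small_segmentation_copy[OF nd sym mod refl] w by blast
  qed
qed

theorem theorem4p4:
  fixes \<psi>0 :: "'p fo2"
    and gs :: "(dir \<times> 'p fo2) list"
    and ds :: "'p fo2 list"
    and \<Psi> :: "'p fo2"
    and \<sigma> :: "'p symb set"
    and h s :: "nat \<Rightarrow> nat"
    and M :: nat
  assumes "normal_data \<psi>0 gs ds"
    and "\<Psi> = normal_sentence \<psi>0 gs ds"
    and "\<sigma> = insert T (symbols \<Psi>)"
    and "exponential h"
    and "small_clique_bound TYPE('p) TYPE('a::infinite) h"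
    and "doubly_exponential s"
    and "splice_bound TYPE('p) TYPE('a) h s"
    and "M = (length gs + 1) * (s (card \<sigma>))\<^sup>2 * h (card \<sigma>)"
  shows "satisfiable TYPE('a) \<Psi> \<longleftrightarrow>
    (\<exists>(A :: ('p, 'a) struct) (S :: nat \<Rightarrow> 'a set).
       univ A \<noteq> {} \<and> (\<forall>j\<le>3. S j \<subseteq> univ A) \<and>
       finite (univ A) \<and> card (univ A) \<le> 4 * M \<and>
       (S 0 = univ A \<and> S 1 = {} \<and> S 2 = {} \<and> S 3 = {} \<or>
        partition_on (univ A) {S 0, S 1, S 2, S 3} \<and> similar_segments \<sigma> A S) \<and>
       (\<forall>a\<in>univ A. \<forall>b\<in>univ A. entails (tp2 \<sigma> A a b) \<psi>0) \<and>
       transp_on (univ A) (tr A) \<and>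
       (\<forall>j\<in>{0, 1, 2}. \<forall>a\<in>S j. \<forall>i<length gs.
          W A (gs ! i) a \<inter> S 0 = {} \<longrightarrow> W A (gs ! i) a \<inter> S (j + 1) \<noteq> {}) \<and>
       (\<forall>a\<in>univ A. \<forall>i<length ds. \<exists>b\<in>Cl A a. holds A a b (guard_both (ds ! i))))"
  unfolding small_segmentation_def[symmetric]
proof
  have sym: "symbols (normal_sentence \<psi>0 gs ds) \<subseteq> \<sigma>" and T: "T \<in> \<sigma>"
    using assms(2,3) by auto
  {
    assume "satisfiable TYPE('a) \<Psi>"
    moreover have sig: "signature \<sigma>"
      using assms(3) finite_symbols by (simp add: signature_def)
    moreover have "normal_form \<Psi>"
      using assms(1,2) by (auto simp: normal_form_def)
    ultimately obtain A :: "('p, 'a) struct"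
      where A: "model A \<Psi>" "cliques_at_most (h (card \<sigma>)) A"
      using assms(2,5) sym unfolding small_clique_bound_def by blast
    have "finite (splice \<sigma> A ` {B. clique A B})" "card (splice \<sigma> A ` {B. clique A B}) \<le> s (card \<sigma>)"
      using assms(7) A sig unfolding splice_bound_def model_def by blast+
    then show "\<exists>(A :: ('p, 'a) struct) S. small_segmentation \<sigma> \<psi>0 gs ds (4 * M) A S"
      using small_segmentation_of_model[OF assms(1) sym T] A assms(2,8)
        clique_bound_le_splice_bound[OF assms(7) sig] by blast
  next
    assume "\<exists>(A :: ('p, 'a) struct) S. small_segmentation \<sigma> \<psi>0 gs ds (4 * M) A S"
    then show "satisfiable TYPE('a) \<Psi>"
      using satisfiable_of_small_segmentation[OF assms(1) sym T] assms(2) by blast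
  }
qed

end
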